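(* Let $D=(D_1,\ldots,D_n)$ be a normalized multiplicity-free diagram, and let $C=(C_1,\ldots,C_n)$ and $C'=(C'_1,\ldots,C'_n)$ be two distinct diagrams with $C\le D$, $C'\le D$ and $x^C=x^{C'}$. Then there is a bijection $\Omega:\mathcal{F}_D(C)\to\mathcal{F}_D(C')$ such that $\mathrm{sgn}(\Omega(F))=\mathrm{sgn}(F)$ and $y^{\Omega(F)}=y^F$ for every $F\in\mathcal{F}_D(C)$.
   Context: A diagram is a subset $D$ of $[n]\times[n]$, $(i,j)$ = row $i$, column $j$ (row 1 on top); $D_j=\{i:(i,j)\in D\}$. For $k$-subsets $R=\{r_1<\cdots<r_k\}$, $S=\{s_1<\cdots<s_k\}$ of $[n]$, $R\le S$ means $r_i\le s_i$ for all $i$; for diagrams, $C\le D$ means $|C_j|=|D_j|$ and $C_j\le D_j$ for all $j$. $x^C=\prod_j\prod_{i\in C_j}x_i$. Normalized: put $\overline{D}_j=([n]\setminus D_j)\cup\{\infty\}$, listed increasingly; for $D_{j_1}\ne D_{j_2}$, $D_{j_1}\prec D_{j_2}$ if $\overline{D}_{j_1}$ is lexicographically smaller than $\overline{D}_{j_2}$. $D$ is normalized if its columns increase weakly from left to right with respect to $\prec$. Multiplicity-free: $D$ is multiplicitous if there exist rows $i_1<i_2<i_3<i_4$ in $[n]$ and distinct columns $c_1\ne c_2$ (either order) such that, listing for rows $i_1,\ldots,i_4$ the pair (status at $c_1$, status at $c_2$) with $\square$ = in $D$, $\times$ = not in $D$, $*$ = unrestricted, the pattern is one of: (A) $(\times,\times),(\square,\times),(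 *,\square),( *,* )$; (B) $(\times,\square),(\times,\times),(\square,\square),(\square,* )$; (C) $(\times,\times),(\times,\times),(\square,\square),(\square,* )$; (D) $(\times,\square),(\square,\times),(\square,\square),( *,* )$; (E) $(\times,\square),(\square,\times),(\square,\times),(\times,\square)$; (F) $(\square,\times),(\times,\square),(\square,\times),(\times,\square)$. Otherwise $D$ is multiplicity-free. Flagged fillings: a flagged filling of $D$ assigns to each box $(i,j)\in D$ a positive integer $c_{ij}$ with $c_{ij}\le i$, such that entries within each column are distinct. $\mathcal{F}_D(C)$ is the set of flagged fillings $F$ of $D$ such that for each $j$ the set of entries in column $j$ is exactly $C_j$. For a column $F_j$, $\mathrm{inv}(F_j)$ is the number of inversions of the word obtained by reading its entries from top to bottom ($0$ if the column is empty); $\mathrm{inv}(F)=\sum_j\mathrm{inv}(F_j)$, $\mathrm{sgn}(F)=(-1)^{\mathrm{inv}(F)}$, and the weight is $y^F=\prod_{(i,j)\in D}y_{c_{ij}\,i}$ (monomial in the indeterminates $y_{ab}$, $a\le b$).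
   Formalization: In "multiplicitous" the fourth row i_4 may also be the empty row n+1 (this affects only patterns (A) and (D)); with i_4 in [n] the claim fails, e.g. n=4, D=(∅,∅,{4},{2}), C=(∅,∅,{2},{1}), C'=(∅,∅,{1},{2}). *)

theory Defs
  imports
    "HOL-Library.Extended_Nat"
    "HOL-Library.FuncSet"
    "HOL-Library.Poly_Mapping"
begin

definition diagram :: "nat \<Rightarrow> (nat \<times> nat) set \<Rightarrow> bool" where
  "diagram n D \<longleftrightarrow> D \<subseteq> {1..n} \<times> {1..n}"

definition column :: "(nat \<times> nat) set \<Rightarrow> nat \<Rightarrow> nat set" where
  "column D j = {i. (i, j) \<in> D}"

definition subset_le :: "nat set \<Rightarrow> nat set \<Rightarrow> bool" where
  "subset_le R S \<longleftrightarrow> card R = card S \<and>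
     (\<forall>i < card R. sorted_list_of_set R ! i \<le> sorted_list_of_set S ! i)"

definition diagram_le :: "nat \<Rightarrow> (nat \<times> nat) set \<Rightarrow> (nat \<times> nat) set \<Rightarrow> bool" where
  "diagram_le n C D \<longleftrightarrow> (\<forall>j \<in> {1..n}. subset_le (column C j) (column D j))"

text \<open>
  Polynomials with integer coefficients in indeterminates indexed by \<open>'a\<close> are the
  finitely supported maps from exponent vectors to coefficients; \<open>indet a\<close> is the
  indeterminate with index \<open>a\<close>.
\<close>

definition indet :: "'a \<Rightarrow> ('a \<Rightarrow>\<^sub>0 nat) \<Rightarrow>\<^sub>0 int" where
  "indet a = Poly_Mapping.single (Poly_Mapping.single a 1) 1"

definition x_monomial :: "nat \<Rightarrow> (nat \<times> nat) set \<Rightarrow> (nat \<Rightarrow>\<^sub>0 nat) \<Rightarrow>\<^sub>0 int" where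
  "x_monomial n C = (\<Prod>j \<in> {1..n}. \<Prod>i \<in> column C j. indet i)"


definition column_bar :: "nat \<Rightarrow> (nat \<times> nat) set \<Rightarrow> nat \<Rightarrow> enat list" where
  "column_bar n D j = sorted_list_of_set (enat ` ({1..n} - column D j) \<union> {\<infinity>})"

definition column_prec :: "nat \<Rightarrow> (nat \<times> nat) set \<Rightarrow> nat \<Rightarrow> nat \<Rightarrow> bool" where
  "column_prec n D j1 j2 \<longleftrightarrow>
     column D j1 \<noteq> column D j2 \<and>
     (column_bar n D j1, column_bar n D j2) \<in> lexord {(a, b). a < b}"

definition normalized :: "nat \<Rightarrow> (nat \<times> nat) set \<Rightarrow> bool" where
  "normalized n D \<longleftrightarrow>
     (\<forall>j1 \<in> {1..n}. \<forall>j2 \<in> {1..n}. j1 < j2 \<longrightarrow>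
        column D j1 = column D j2 \<or> column_prec n D j1 j2)"


datatype status = Box | Cross | Star

fun has_status :: "(nat \<times> nat) set \<Rightarrow> nat \<Rightarrow> nat \<Rightarrow> status \<Rightarrow> bool" where
  "has_status D i j Box \<longleftrightarrow> (i, j) \<in> D"
| "has_status D i j Cross \<longleftrightarrow> (i, j) \<notin> D"
| "has_status D i j Star \<longleftrightarrow> True"

text \<open>
  Each pattern lists, for four rows from top to bottom, the statuses in two columns.
\<close>

definition multiplicitous_patterns :: "(status \<times> status) list set" where
  "multiplicitous_patterns =
    {[(Cross, Cross), (Box, Cross), (Star, Box), (Star, Star)],
     [(Cross, Box), (Cross, Cross), (Box, Box), (Box, Star)],
     [(Cross, Cross), (Cross, Cross), (Box, Box), (Box, Star)],
     [(Cross, Box), (Box, Cross), (Box, Box), (Star, Star)],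
     [(Cross, Box), (Box, Cross), (Box, Cross), (Cross, Box)],
     [(Box, Cross), (Cross, Box), (Box, Cross), (Cross, Box)]}"

text \<open>
  The columns \<open>c1\<close> and \<open>c2\<close> are ordered only by their role in the pattern: either may
  be the one further to the left.

  The fourth row is allowed to be the empty row \<open>n + 1\<close> just below the grid.  This matters
  only for the first and fourth pattern, whose fourth row is unrestricted; the other
  patterns require a box in the fourth row, which then lies in \<open>{1..n}\<close>.  With the fourth row confined to \<open>{1..n}\<close>,
  the \<open>4 \<times> 4\<close> diagram with boxes \<open>(4, 3)\<close> and \<open>(2, 4)\<close> would count as multiplicity-free,
  although \<open>{(2, 3), (1, 4)}\<close> and \<open>{(1, 3), (2, 4)}\<close> have equal \<open>x\<close>-weight while their unique
  fillings have different weights \<open>y\<^sub>2\<^sub>4 y\<^sub>1\<^sub>2\<close> and \<open>y\<^sub>1\<^sub>4 y\<^sub>2\<^sub>2\<close>.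
\<close>

definition multiplicitous :: "nat \<Rightarrow> (nat \<times> nat) set \<Rightarrow> bool" where
  "multiplicitous n D \<longleftrightarrow>
     (\<exists>i1 \<in> {1..n}. \<exists>i2 \<in> {1..n}. \<exists>i3 \<in> {1..n}. \<exists>i4 \<in> {1..n + 1}.
      \<exists>c1 \<in> {1..n}. \<exists>c2 \<in> {1..n}.
        i1 < i2 \<and> i2 < i3 \<and> i3 < i4 \<and> c1 \<noteq> c2 \<and>
        (\<exists>P \<in> multiplicitous_patterns.
           list_all2 (\<lambda>i (s1, s2). has_status D i c1 s1 \<and> has_status D i c2 s2)
             [i1, i2, i3, i4] P))"

definition multiplicity_free :: "nat \<Rightarrow> (nat \<times> nat) set \<Rightarrow> bool" where
  "multiplicity_free n D \<longleftrightarrow> \<not> multiplicitous n D"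


text \<open>
  A filling is a function on the boxes of \<open>D\<close>, extended by \<open>undefined\<close> elsewhere, so that
  distinct elements of this set are distinct as fillings of \<open>D\<close>.
\<close>

definition flagged_fillings :: "(nat \<times> nat) set \<Rightarrow> (nat \<times> nat \<Rightarrow> nat) set" where
  "flagged_fillings D =
     {F \<in> Pi\<^sub>E D (\<lambda>(i, j). {1..i}). \<forall>j. inj_on (\<lambda>i. F (i, j)) (column D j)}"

definition flagged_fillings_content ::
    "nat \<Rightarrow> (nat \<times> nat) set \<Rightarrow> (nat \<times> nat) set \<Rightarrow> (nat \<times> nat \<Rightarrow> nat) set" where
  "flagged_fillings_content n D C =
     {F \<in> flagged_fillings D.
        \<forall>j \<in> {1..n}. (\<lambda>i. F (i, j)) ` column D j = column C j}"

definition column_word :: "(nat \<times> nat) set \<Rightarrow> (nat \<times> nat \<Rightarrow> nat) \<Rightarrow> nat \<Rightarrow> nat list" where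
  "column_word D F j = map (\<lambda>i. F (i, j)) (sorted_list_of_set (column D j))"

definition inversions :: "nat list \<Rightarrow> nat" where
  "inversions w = card {(p, q). p < q \<and> q < length w \<and> w ! p > w ! q}"

definition filling_inv :: "nat \<Rightarrow> (nat \<times> nat) set \<Rightarrow> (nat \<times> nat \<Rightarrow> nat) \<Rightarrow> nat" where
  "filling_inv n D F = (\<Sum>j \<in> {1..n}. inversions (column_word D F j))"

definition filling_sgn :: "nat \<Rightarrow> (nat \<times> nat) set \<Rightarrow> (nat \<times> nat \<Rightarrow> nat) \<Rightarrow> int" where
  "filling_sgn n D F = (- 1) ^ filling_inv n D F"

definition y_monomial ::
    "(nat \<times> nat) set \<Rightarrow> (nat \<times> nat \<Rightarrow> nat) \<Rightarrow> (nat \<times> nat \<Rightarrow>\<^sub>0 nat) \<Rightarrow>\<^sub>0 int" where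
  "y_monomial D F = (\<Prod>(i, j) \<in> D. indet (F (i, j), i))"

end

theory Submission
  imports Defs "HOL-Combinatorics.Transposition"
begin

text \<open>
  Call a column of \<open>C\<close> tight at row \<open>a\<close> if it has as many entries above row \<open>a\<close> as the column of
  \<open>D\<close>.  If columns \<open>j\<close> and \<open>k\<close> are both tight at \<open>a\<close> and at \<open>b\<close>, and \<open>D\<^sub>j\<close>, \<open>D\<^sub>k\<close> agree on the
  rows \<open>a \<le> r < b\<close>, then every flagged filling with content \<open>C\<close> uses in these rows exactly the
  entries between \<open>a\<close> and \<open>b\<close>.  Exchanging the two columns in these rows, in the filling and in \<open>C\<close>,
  therefore preserves the weight \<open>y\<^sup>F\<close> and the number of inversions.

  Any two admissible \<open>C\<close>, \<open>C'\<close> of equal \<open>x\<close>-weight are connected by such exchanges.  In the first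
  row \<open>i\<close> where they differ there are columns with \<open>i \<in> C\<^sub>j - C'\<^sub>j\<close> and \<open>i \<in> C'\<^sub>k - C\<^sub>k\<close>, so both
  \<open>D\<^sub>j\<close> and \<open>D\<^sub>k\<close> have a gap weakly above and a box strictly below row \<open>i\<close>.  Avoidance of the
  patterns then makes \<open>D\<^sub>j\<close> and \<open>D\<^sub>k\<close> agree around row \<open>i\<close>, down to the last box of whichever column
  ends first; exchanging in \<open>C'\<close> if this is column \<open>k\<close>, and in \<open>C\<close> otherwise, reduces the number of
  differences in row \<open>i\<close>.
\<close>

section \<open>Pairs of columns avoiding the multiplicitous patterns\<close>

text \<open>
  The first two patterns are listed with three rows only: their fourth row is unrestricted and may be
  row \<open>n + 1\<close>, so it always exists.
\<close>

definition avoids :: "nat set \<Rightarrow> nat set \<Rightarrow> bool" where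
  "avoids J K \<longleftrightarrow> (\<forall>r1 r2 r3. 1 \<le> r1 \<longrightarrow> r1 < r2 \<longrightarrow> r2 < r3 \<longrightarrow>
     \<not> (r1 \<notin> J \<and> r1 \<notin> K \<and> r2 \<in> J \<and> r2 \<notin> K \<and> r3 \<in> K) \<and>
     \<not> (r1 \<notin> J \<and> r1 \<in> K \<and> r2 \<in> J \<and> r2 \<notin> K \<and> r3 \<in> J \<and> r3 \<in> K) \<and>
     (\<forall>r4 > r3.
       \<not> (r1 \<notin> J \<and> r1 \<in> K \<and> r2 \<notin> J \<and> r2 \<notin> K \<and> r3 \<in> J \<and> r3 \<in> K \<and> r4 \<in> J) \<and>
       \<not> (r1 \<notin> J \<and> r1 \<notin> K \<and> r2 \<notin> J \<and> r2 \<notin> K \<and> r3 \<in> J \<and> r3 \<in> K \<and> r4 \<in> J) \<and>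
       \<not> (r1 \<notin> J \<and> r1 \<in> K \<and> r2 \<in> J \<and> r2 \<notin> K \<and> r3 \<in> J \<and> r3 \<notin> K \<and> r4 \<notin> J \<and> r4 \<in> K) \<and>
       \<not> (r1 \<in> J \<and> r1 \<notin> K \<and> r2 \<notin> J \<and> r2 \<in> K \<and> r3 \<in> J \<and> r3 \<notin> K \<and> r4 \<notin> J \<and> r4 \<in> K)))"

lemma avoids_if_multiplicity_free:
  assumes D: "diagram n D" and free: "multiplicity_free n D"
    and c: "c1 \<in> {1..n}" "c2 \<in> {1..n}" "c1 \<noteq> c2"
  shows "avoids (column D c1) (column D c2)"
proof -
  have mem: "i \<in> {1..n}" if "(i, c) \<in> D" for i c
    using D that by (auto simp: diagram_def)
  have forbid: False
    if "list_all2 (\<lambda>i (s1, s2). has_status D i c1 s1 \<and> has_status D i c2 s2) [i1, i2, i3, i4] P"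
      "P \<in> multiplicitous_patterns" "1 \<le> i1" "i1 < i2" "i2 < i3" "i3 < i4" "i3 \<le> n" "i4 \<le> n + 1"
    for i1 i2 i3 i4 P
  proof -
    have "i1 \<in> {1..n}" "i2 \<in> {1..n}" "i3 \<in> {1..n}" "i4 \<in> {1..n + 1}"
      using that by auto
    then show False
      using free that c unfolding multiplicity_free_def multiplicitous_def by blast
  qed
  show ?thesis
    unfolding avoids_def
  proof (intro allI impI conjI notI; elim conjE; (unfold column_def mem_Collect_eq)?)
    fix r1 r2 r3 :: nat assume r: "1 \<le> r1" "r1 < r2" "r2 < r3"
    {
      assume "(r1, c1) \<notin> D" "(r1, c2) \<notin> D" "(r2, c1) \<in> D" "(r2, c2) \<notin> D" "(r3, c2) \<in> D"
      with r mem[of r3] show False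
        by (intro forbid[of r1 r2 r3 "n + 1" "[(Cross, Cross), (Box, Cross), (Star, Box), (Star, Star)]"])
          (force simp: multiplicitous_patterns_def)+
    next
      assume "(r1, c1) \<notin> D" "(r1, c2) \<in> D" "(r2, c1) \<in> D" "(r2, c2) \<notin> D" "(r3, c1) \<in> D" "(r3, c2) \<in> D"
      with r mem[of r3] show False
        by (intro forbid[of r1 r2 r3 "n + 1" "[(Cross, Box), (Box, Cross), (Box, Box), (Star, Star)]"])
          (force simp: multiplicitous_patterns_def)+
    }
    fix r4 :: nat assume r4: "r3 < r4"
    {
      assume "(r1, c1) \<notin> D" "(r1, c2) \<in> D" "(r2, c1) \<notin> D" "(r2, c2) \<notin> D" "(r3, c1) \<in> D" "(r3, c2) \<in> D" "(r4, c1) \<in> D"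
      with r r4 mem[of r4] mem[of r3] show False
        by (intro forbid[of r1 r2 r3 r4 "[(Cross, Box), (Cross, Cross), (Box, Box), (Box, Star)]"])
          (force simp: multiplicitous_patterns_def)+
    next
      assume "(r1, c1) \<notin> D" "(r1, c2) \<notin> D" "(r2, c1) \<notin> D" "(r2, c2) \<notin> D" "(r3, c1) \<in> D" "(r3, c2) \<in> D" "(r4, c1) \<in> D"
      with r r4 mem[of r4] mem[of r3] show False
        by (intro forbid[of r1 r2 r3 r4 "[(Cross, Cross), (Cross, Cross), (Box, Box), (Box, Star)]"])
          (force simp: multiplicitous_patterns_def)+
    next
      assume "(r1, c1) \<notin> D" "(r1, c2) \<in> D" "(r2, c1) \<in> D" "(r2, c2) \<notin> D" "(r3, c1) \<in> D" "(r3, c2) \<notin> D"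
        "(r4, c1) \<notin> D" "(r4, c2) \<in> D"
      with r r4 mem[of r4] mem[of r3] show False
        by (intro forbid[of r1 r2 r3 r4 "[(Cross, Box), (Box, Cross), (Box, Cross), (Cross, Box)]"])
          (force simp: multiplicitous_patterns_def)+
    next
      assume "(r1, c1) \<in> D" "(r1, c2) \<notin> D" "(r2, c1) \<notin> D" "(r2, c2) \<in> D" "(r3, c1) \<in> D" "(r3, c2) \<notin> D"
        "(r4, c1) \<notin> D" "(r4, c2) \<in> D"
      with r r4 mem[of r4] mem[of r3] show False
        by (intro forbid[of r1 r2 r3 r4 "[(Box, Cross), (Cross, Box), (Box, Cross), (Cross, Box)]"])
          (force simp: multiplicitous_patterns_def)+
    }
  qed
qed

text \<open>
  Here \<open>K\<close> is the column that ends first, and \<open>m\<close> is its last box.  The alternatives in the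
  conclusion are those under which both column sets are tight at rows \<open>a\<close> and \<open>m + 1\<close>.
\<close>

lemma common_window:
  assumes av: "avoids J K" "avoids K J"
    and sub: "J \<subseteq> {1..n}" "K \<subseteq> {1..n}"
    and gapJ: "\<exists>p \<le> i. 1 \<le> p \<and> p \<notin> J" and gapK: "\<exists>p \<le> i. 1 \<le> p \<and> p \<notin> K"
    and boxes: "i < m" "m \<in> K" "K \<subseteq> {..m}" "e \<in> J" "m \<le> e" "J \<subseteq> {..e}"
  shows "\<exists>a \<le> i. 1 \<le> a \<and> J \<inter> {a..m} = K \<inter> {a..m} \<and>
    (J \<inter> {..i} = {1..i} - {a} \<and> K \<inter> {..i} = {1..i} - {a} \<or>
      a = i \<and> K \<inter> {i..} = {m} \<and> (J \<inter> {i..} = {m} \<or> J \<inter> {..i} = {1..<i})) \<and>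
    (J \<inter> {m..} = {m} \<or> J \<inter> {..m} = {1..m} - {a})"
proof -
  \<comment> \<open>\<open>A\<close> to \<open>EF\<close> are the forbidden patterns.
    \<open>A\<close>, \<open>B\<close> and \<open>D\<close> are stated for both assignments of
    \<open>J\<close> and \<open>K\<close> to the pattern columns. \<open>EF\<close> merges the last
    two patterns, which share their lower two rows, with the lowest box in \<open>J\<close>.\<close>
  have A: False if "1 \<le> r1" "r1 < r2" "r2 < r3" "r1 \<notin> J" "r1 \<notin> K"
    "r2 \<in> J \<and> r2 \<notin> K \<and> r3 \<in> K \<or> r2 \<notin> J \<and> r2 \<in> K \<and> r3 \<in> J" for r1 r2 r3
    using av that unfolding avoids_def by meson
  have B: False if "1 \<le> r1" "r1 < r2" "r2 < r3" "r3 < r4" "r2 \<notin> J" "r2 \<notin> K" "r3 \<in> J" "r3 \<in> K"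
    "r1 \<notin> J \<and> r1 \<in> K \<and> r4 \<in> J \<or> r1 \<in> J \<and> r1 \<notin> K \<and> r4 \<in> K" for r1 r2 r3 r4
    using av that unfolding avoids_def by meson
  have C: False if "1 \<le> r1" "r1 < r2" "r2 < r3" "r3 < r4" "r1 \<notin> J" "r1 \<notin> K" "r2 \<notin> J" "r2 \<notin> K"
    "r3 \<in> J" "r3 \<in> K" "r4 \<in> J" for r1 r2 r3 r4
    using av that unfolding avoids_def by meson
  have D: False if "1 \<le> r1" "r1 < r2" "r2 < r3" "r3 \<in> J" "r3 \<in> K"
    "r1 \<notin> J \<and> r1 \<in> K \<and> r2 \<in> J \<and> r2 \<notin> K \<or> r1 \<in> J \<and> r1 \<notin> K \<and> r2 \<notin> J \<and> r2 \<in> K" for r1 r2 r3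
    using av that unfolding avoids_def by meson
  have EF: False if "1 \<le> r1" "r1 < r2" "r2 < r3" "r3 < r4" "r3 \<notin> J" "r3 \<in> K" "r4 \<in> J" "r4 \<notin> K"
    "r1 \<notin> J \<and> r1 \<in> K \<and> r2 \<in> J \<and> r2 \<notin> K \<or> r1 \<in> J \<and> r1 \<notin> K \<and> r2 \<notin> J \<and> r2 \<in> K" for r1 r2 r3 r4
    using av that unfolding avoids_def by meson
  define gJ where "gJ = (LEAST p. 1 \<le> p \<and> p \<notin> J)"
  define gK where "gK = (LEAST p. 1 \<le> p \<and> p \<notin> K)"
  have gJ: "1 \<le> gJ" "gJ \<notin> J" "gJ \<le> i" "\<And>p. 1 \<le> p \<Longrightarrow> p < gJ \<Longrightarrow> p \<in> J"
  proof -
    obtain p where p: "p \<le> i" "1 \<le> p \<and> p \<notin> J" using gapJ by blast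
    show "1 \<le> gJ" "gJ \<notin> J" using LeastI[of "\<lambda>p. 1 \<le> p \<and> p \<notin> J", OF p(2)] by (simp_all add: gJ_def)
    show "gJ \<le> i" using Least_le[of "\<lambda>p. 1 \<le> p \<and> p \<notin> J", OF p(2)] p(1) by (simp add: gJ_def)
    show "\<And>p. 1 \<le> p \<Longrightarrow> p < gJ \<Longrightarrow> p \<in> J" using not_less_Least unfolding gJ_def by blast
  qed
  have gK: "1 \<le> gK" "gK \<notin> K" "gK \<le> i" "\<And>p. 1 \<le> p \<Longrightarrow> p < gK \<Longrightarrow> p \<in> K"
  proof -
    obtain p where p: "p \<le> i" "1 \<le> p \<and> p \<notin> K" using gapK by blast
    show "1 \<le> gK" "gK \<notin> K" using LeastI[of "\<lambda>p. 1 \<le> p \<and> p \<notin> K", OF p(2)] by (simp_all add: gK_def)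
    show "gK \<le> i" using Least_le[of "\<lambda>p. 1 \<le> p \<and> p \<notin> K", OF p(2)] p(1) by (simp add: gK_def)
    show "\<And>p. 1 \<le> p \<Longrightarrow> p < gK \<Longrightarrow> p \<in> K" using not_less_Least unfolding gK_def by blast
  qed
  have pos: "1 \<le> r" if "r \<in> J \<or> r \<in> K" for r using sub that by auto
  have eK: "e \<notin> K" if "m < e" using boxes that by auto
  \<comment> \<open>The later first gap \<open>s\<close> is missing from both columns: otherwise
    each column has a box at the first gap of the other, and these two rows give \<open>D\<close>
    together with \<open>m\<close> if \<open>m\<close> lies in \<open>J\<close>, and
    \<open>EF\<close> together with \<open>m\<close> and \<open>e\<close> if not.\<close>
  define s where "s = max gJ gK"
  have s: "1 \<le> s" "s \<le> i" using gJ gK by (auto simp: s_def)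
  have s_gap: "s \<notin> J \<and> s \<notin> K"
  proof (cases gJ gK rule: linorder_cases)
    case equal then show ?thesis using gJ gK by (simp add: s_def)
  next
    case greater
    then have g: "gK \<in> J" using gJ gK by auto
    have "gJ \<notin> K"
    proof
      assume gJK: "gJ \<in> K"
      show False
      proof (cases "m \<in> J")
        case True then show False
          using D[of gK gJ m] gJ gK greater g gJK boxes by auto
      next
        case False
        then have "m < e" using boxes le_neq_implies_less by blast
        then show False
          using EF[of gK gJ m e] False gJ gK greater g gJK boxes eK by auto
      qed
    qed
    then show ?thesis using greater gJ by (simp add: s_def)
  next
    case less
    then have g: "gJ \<in> K" using gJ gK by auto
    have "gK \<notin> J"
    proof
      assume gKJ: "gK \<in> J"
      show False
      proof (cases "m \<in> J")
        case True then show False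
          using D[of gJ gK m] gJ gK less g gKJ boxes by auto
      next
        case False
        then have "m < e" using boxes le_neq_implies_less by blast
        then show False
          using EF[of gJ gK m e] False gJ gK less g gKJ boxes eK by auto
      qed
    qed
    then show ?thesis using less gK by (simp add: s_def)
  qed
  \<comment> \<open>Below the common gap \<open>s\<close>, a row with a box in only one column,
    followed by a box of the other column, is pattern \<open>A\<close>. This puts \<open>m\<close>
    in \<open>J\<close> and makes the columns agree from \<open>s\<close> down to
    \<open>m\<close>.\<close>
  have mJ: "m \<in> J"
  proof (rule ccontr)
    assume no: "m \<notin> J"
    then have "m < e" using boxes le_neq_implies_less by blast
    then show False using A[of s m e] no s s_gap boxes by auto
  qed
  have agree: "r \<in> J \<longleftrightarrow> r \<in> K" if sr: "s \<le> r" "r \<le> m" for r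
  proof -
    consider "r = s" | "r = m" | "s < r" "r < m" using sr by linarith
    then show ?thesis
      using A[of s r m] s s_gap mJ boxes by cases auto
  qed
  \<comment> \<open>A second common gap above the common box \<open>m\<close> yields
    \<open>C\<close> as soon as \<open>J\<close> has a box below \<open>m\<close>.\<close>
  have after: "J \<inter> {m..} = {m}" if "s < g" "g < m" "g \<notin> J" for g
  proof -
    have "r \<notin> J" if "m < r" for r
      using C[of s g m r] \<open>s < g\<close> \<open>g < m\<close> \<open>g \<notin> J\<close> agree[of g] that s s_gap mJ boxes by auto
    then show ?thesis using mJ by (auto simp: order_le_less)
  qed
  show ?thesis
  proof (cases "gJ = gK")
    case True
    then have eq: "gJ = s" "gK = s" by (simp_all add: s_def)
    have last: "J \<inter> {m..} = {m} \<or> J \<inter> {..m} = {1..m} - {s}"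
    proof (cases "\<exists>g. s < g \<and> g < m \<and> g \<notin> J")
      case True then show ?thesis using after by blast
    next
      case False
      have "r \<in> J \<longleftrightarrow> 1 \<le> r \<and> r \<noteq> s" if "r \<le> m" for r
        using False gJ(4)[of r] eq s_gap pos[of r] mJ that by (metis le_neq_implies_less linorder_neqE_nat)
      then show ?thesis by auto
    qed
    show ?thesis
    \<comment> \<open>If \<open>s\<close> is the only gap down to row \<open>i\<close>, the window
      starts at \<open>s\<close>. With a second gap \<open>g\<close>, \<open>C\<close> leaves
      \<open>m\<close> as the only box of either column from row \<open>i\<close> on, and the window
      starts at \<open>i\<close>.\<close>
    proof (cases "\<exists>g. s < g \<and> g \<le> i \<and> g \<notin> J")
      case False
      have J: "r \<in> J \<longleftrightarrow> 1 \<le> r \<and> r \<noteq> s" if "r \<le> i" for r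
        using False gJ(4)[of r] eq s_gap pos[of r] that by (metis linorder_neqE_nat)
      have K: "r \<in> K \<longleftrightarrow> r \<in> J" if "r \<le> i" for r
      proof (cases "s \<le> r")
        case True then show ?thesis using agree[of r] that boxes(1) by simp
      next
        case False then show ?thesis using gJ(4)[of r] gK(4)[of r] pos[of r] unfolding eq by (meson not_le)
      qed
      have "J \<inter> {..i} = {1..i} - {s}" using J by auto
      moreover have "K \<inter> {..i} = J \<inter> {..i}" using K by auto
      moreover have "J \<inter> {s..m} = K \<inter> {s..m}" using agree by auto
      ultimately show ?thesis using last s by (intro exI[of _ s]) simp
    next
      case True
      then obtain g where g: "s < g" "g \<le> i" "g \<notin> J" by blast
      then have gm: "g < m" using boxes by simp
      have aft: "J \<inter> {m..} = {m}" using after[OF g(1) gm g(3)] .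
      have none: "r \<notin> J" if "g < r" "r < m" for r
        using C[of s g r m] agree[of g] agree[of r] g gm s s_gap mJ boxes that by auto
      have J: "J \<inter> {i..} = {m}"
      proof -
        have "r = m" if "r \<in> J" "i \<le> r" for r
        proof -
          have "g < r" using that g by (metis le_trans order_le_less)
          then show ?thesis using none[of r] aft that by (metis IntI atLeast_iff linorder_not_less singletonD)
        qed
        then have "J \<inter> {i..} \<subseteq> {m}" by blast
        then show ?thesis using mJ boxes(1) by auto
      qed
      have ag: "J \<inter> {i..m} = K \<inter> {i..m}" using agree s by auto
      have K: "K \<inter> {i..} = {m}"
      proof -
        have "K \<inter> {i..} = K \<inter> {i..m}" using boxes by auto
        also have "\<dots> = {m}" using ag J mJ boxes by auto
        finally show ?thesis .
      qed
      show ?thesis using ag J K aft s by (intro exI[of _ i]) simp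
    qed
  next
    case False
    \<comment> \<open>With distinct first gaps, the earlier one is a box of exactly one column, so a
      common box between \<open>s\<close> and \<open>m\<close> would give \<open>B\<close>.\<close>
    have none: "r \<notin> J \<and> r \<notin> K" if "s \<le> r" "r < m" for r
    proof (rule ccontr)
      assume "\<not> (r \<notin> J \<and> r \<notin> K)"
      then have r: "r \<in> J" "r \<in> K" "s < r" using agree[of r] that s_gap by (auto simp: order_le_less)
      have "min gJ gK < s" "1 \<le> min gJ gK" using False gJ gK by (auto simp: s_def)
      moreover have "min gJ gK \<notin> J \<and> min gJ gK \<in> K \<or> min gJ gK \<in> J \<and> min gJ gK \<notin> K"
        using False gJ gK by (auto simp: min_def)
      ultimately show False
        using B[of "min gJ gK" s r m] r that s_gap mJ boxes by auto
    qed
    have ag: "J \<inter> {i..m} = K \<inter> {i..m}" using agree s by auto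
    have K: "K \<inter> {i..} = {m}"
    proof -
      have "r = m" if "r \<in> K" "i \<le> r" for r
        using none[of r] that s boxes by (metis atMost_iff le_trans order_le_less subset_iff)
      then have "K \<inter> {i..} \<subseteq> {m}" by blast
      then show ?thesis using boxes(1,2) by auto
    qed
    have J_low: "r = m" if "r \<in> J" "i \<le> r" "r \<le> m" for r
      using none[of r] that s by (metis le_trans order_le_less)
    show ?thesis
    proof (cases "\<exists>r \<in> J. m < r")
      case False
      then have J: "J \<inter> {i..} \<subseteq> {m}" using J_low by fastforce
      then have "J \<inter> {i..} = {m}" "J \<inter> {m..} = {m}"
        using mJ boxes(1) by auto
      then show ?thesis using ag K s by (intro exI[of _ i]) simp
    next
      case True
      then obtain r where r: "r \<in> J" "m < r" by blast
      \<comment> \<open>Here \<open>J\<close> continues below \<open>m\<close>. Then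
        \<open>B\<close> forces the earlier first gap to be that of \<open>K\<close>, and
        \<open>C\<close> leaves no row between \<open>s\<close> and \<open>m\<close>; hence
        \<open>s = i\<close>, \<open>m = Suc i\<close>, and \<open>J\<close> is full above row
        \<open>i\<close>.\<close>
      have "gK < gJ"
      proof (rule ccontr)
        assume "\<not> gK < gJ"
        then have l: "gJ < gK" "s = gK" using False by (auto simp: s_def)
        then show False
          using B[of gJ gK m r] gJ gK(4)[of gJ] r s_gap mJ boxes gK by auto
      qed
      then have sJ: "s = gJ" by (simp add: s_def)
      have "Suc s = m"
      proof (rule ccontr)
        assume "Suc s \<noteq> m"
        then have l: "Suc s < m" using s boxes by linarith
        then show False
          using C[of s "Suc s" m r] none[of "Suc s"] s s_gap mJ boxes r by auto
      qed
      then have si: "s = i" "m = Suc i" using s boxes by auto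
      have J: "r \<in> J \<longleftrightarrow> 1 \<le> r" if "r < i" for r
        using gJ(4)[of r] pos[of r] sJ si that by blast
      then have "J \<inter> {..i} = {1..<i}" using s_gap si(1) by (auto simp: order_le_less)
      moreover have "J \<inter> {..m} = {1..m} - {i}"
      proof -
        have "r \<in> J \<longleftrightarrow> 1 \<le> r \<and> r \<noteq> i" if rm: "r \<le> m" for r
        proof -
          consider "r < i" | "r = i" | "r = m" using rm si(2) by linarith
          then show ?thesis using J[of r] mJ s_gap si by cases auto
        qed
        then show ?thesis by auto
      qed
      ultimately show ?thesis using ag K s by (intro exI[of _ i]) simp
    qed
  qed
qed

section \<open>Dominated column sets\<close>

abbreviation count_below :: "nat set \<Rightarrow> nat \<Rightarrow> nat" where
  "count_below X r \<equiv> card (X \<inter> {..<r})"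

text \<open>A counting form of \<open>subset_le\<close>: counts, unlike sorted lists, split at the
  ends of a window, and equality in the last clause at row \<open>r\<close> is tightness at
  \<open>r\<close>.\<close>

definition dominated :: "nat \<Rightarrow> nat set \<Rightarrow> nat set \<Rightarrow> bool" where
  "dominated n P J \<longleftrightarrow> P \<subseteq> {1..n} \<and> J \<subseteq> {1..n} \<and> card P = card J \<and>
     (\<forall>r. count_below J r \<le> count_below P r)"

text \<open>Elements below \<open>r\<close> correspond to positions of the sorted list with value
  below \<open>r\<close>, and the entrywise inequality becomes an inclusion of these sets of
  positions.\<close>

lemma dominated_if_subset_le:
  assumes "P \<subseteq> {1..n}" "J \<subseteq> {1..n}" "subset_le P J"
  shows "dominated n P J"
proof -
  have fin: "finite P" "finite J" using assms(1,2) finite_subset by blast+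
  have count: "count_below S r = card {t. t < card S \<and> sorted_list_of_set S ! t < r}"
    if "finite S" for S r
  proof -
    let ?l = "sorted_list_of_set S"
    have "bij_betw (\<lambda>t. ?l ! t) {t. t < card S \<and> ?l ! t < r} (S \<inter> {..<r})"
    proof (rule bij_betw_imageI)
      show "inj_on (\<lambda>t. ?l ! t) {t. t < card S \<and> ?l ! t < r}"
        using that by (auto simp: inj_on_def nth_eq_iff_index_eq)
      have "S \<inter> {..<r} = {x \<in> set ?l. x < r}" using that by auto
      also have "\<dots> = (\<lambda>t. ?l ! t) ` {t. t < card S \<and> ?l ! t < r}"
        unfolding set_conv_nth using that by auto
      finally show "(\<lambda>t. ?l ! t) ` {t. t < card S \<and> ?l ! t < r} = S \<inter> {..<r}" ..
    qed
    then show ?thesis by (metis bij_betw_same_card)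
  qed
  have "count_below J r \<le> count_below P r" for r
    unfolding count[OF fin(1)] count[OF fin(2)]
    using assms(3) by (intro card_mono) (auto simp: subset_le_def intro: le_less_trans)
  then show ?thesis using assms by (auto simp: dominated_def subset_le_def)
qed

lemma count_below_split:
  assumes "finite X" "a \<le> r"
  shows "count_below X r = count_below X a + card (X \<inter> {a..<r})"
proof -
  have "X \<inter> {..<r} = (X \<inter> {..<a}) \<union> (X \<inter> {a..<r})" using assms by auto
  moreover have "card \<dots> = count_below X a + card (X \<inter> {a..<r})"
    using assms by (intro card_Un_disjoint) auto
  ultimately show ?thesis by simp
qed

lemma count_below_Suc:
  "count_below X (Suc r) = count_below X r + (if r \<in> X then 1 else 0)"
  by (simp add: lessThan_Suc)

lemma count_below_le_card: "finite X \<Longrightarrow> count_below X r \<le> card X"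
  by (simp add: card_mono)

lemma dominatedD:
  assumes "dominated n P J"
  shows "finite P" "finite J" "P \<subseteq> {1..n}" "J \<subseteq> {1..n}" "card P = card J"
    "count_below J r \<le> count_below P r"
  using assms finite_subset[of _ "{1..n}"] unfolding dominated_def by blast+

section \<open>Tightness near the first row where two admissible columns differ\<close>

lemma tight_above:
  assumes "dominated n P J" "J \<subseteq> {..<r}"
  shows "count_below P r = count_below J r"
proof -
  have "J \<inter> {..<r} = J" using assms by auto
  then show ?thesis
    using dominatedD[OF assms(1)] count_below_le_card[of P r] by (metis order_antisym)
qed

text \<open>Since \<open>P'\<close> skips row \<open>i\<close>, \<open>J\<close> has through row
  \<open>i\<close> at most as many boxes as \<open>P'\<close> has entries above it, which is one
  fewer than \<open>P\<close> has through row \<open>i\<close>. So \<open>J\<close> is not full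
  through row \<open>i\<close> and has a box left below: the gap and the box needed in
  \<open>common_window\<close>.\<close>

lemma active_row:
  assumes dom: "dominated n P J" "dominated n P' J"
    and i: "P \<inter> {..<i} = P' \<inter> {..<i}" "i \<in> P" "i \<notin> P'"
  shows "1 \<le> i" "\<exists>p \<le> i. 1 \<le> p \<and> p \<notin> J" "\<exists>p \<in> J. i < p"
    "count_below P (Suc i) = Suc (count_below P' i)"
    "count_below J (Suc i) \<le> count_below P' i"
    "Suc (count_below P' i) \<le> card J"
proof -
  show i1: "1 \<le> i" using i dominatedD(3)[OF dom(1)] by auto
  show P: "count_below P (Suc i) = Suc (count_below P' i)"
    using i by (simp add: count_below_Suc)
  show J: "count_below J (Suc i) \<le> count_below P' i"
    using dominatedD(6)[OF dom(2), of "Suc i"] i by (simp add: count_below_Suc)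
  show c: "Suc (count_below P' i) \<le> card J"
    using P count_below_le_card[of P "Suc i"] dominatedD(1,5)[OF dom(1)] by simp
  show "\<exists>p \<le> i. 1 \<le> p \<and> p \<notin> J"
  proof (rule ccontr)
    assume "\<not> ?thesis"
    then have "{1..i} \<subseteq> J \<inter> {..<Suc i}" by auto
    then have "card {1..i} \<le> count_below J (Suc i)" by (rule card_mono[rotated]) simp
    moreover have "P \<inter> {..<Suc i} \<subseteq> {1..i}" using dominatedD(3)[OF dom(1)] by auto
    then have "count_below P (Suc i) \<le> card {1..i}" by (rule card_mono[rotated]) simp
    ultimately show False using P J by simp
  qed
  show "\<exists>p \<in> J. i < p"
  proof (rule ccontr)
    assume "\<not> ?thesis"
    then have "J \<inter> {..<Suc i} = J" by (auto simp: not_less)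
    then show False using J c by simp
  qed
qed

text \<open>Comparison with \<open>P\<close> leaves \<open>P'\<close> at most
  \<open>card J - 1\<close> entries above row \<open>i\<close>, and \<open>J\<close> already has
  that many boxes there, as only \<open>m\<close> is left.\<close>

lemma tight_before_last_box:
  assumes dom: "dominated n P J" "dominated n P' J"
    and i: "P \<inter> {..<i} = P' \<inter> {..<i}" "i \<in> P" "i \<notin> P'"
    and J: "J \<inter> {i..} = {m}"
  shows "count_below P' i = count_below J i"
proof -
  have "J \<subseteq> insert m (J \<inter> {..<i})" using J by fastforce
  then have "card J \<le> card (insert m (J \<inter> {..<i}))" by (rule card_mono[rotated]) simp
  also have "\<dots> \<le> Suc (count_below J i)" by (simp add: card_insert_if)
  finally show ?thesis
    using active_row(6)[OF dom i] dominatedD(6)[OF dom(2), of i] by simp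
qed

text \<open>\<open>J\<close> has \<open>i - 1\<close> boxes through row \<open>i\<close>, and
  \<open>P'\<close>, which skips \<open>i\<close>, can match them only by using all values below
  \<open>i\<close>.\<close>

lemma full_below_active_row:
  assumes dom: "dominated n P J" "dominated n P' J"
    and i: "P \<inter> {..<i} = P' \<inter> {..<i}" "i \<in> P" "i \<notin> P'"
    and J: "J \<inter> {..i} = {1..i} - {a}" "1 \<le> a" "a \<le> i"
  shows "P' \<inter> {..<i} = {1..<i}"
proof -
  have "J \<inter> {..<Suc i} = {1..i} - {a}" using J by (simp add: lessThan_Suc_atMost)
  then have "count_below J (Suc i) = i - 1" using J by simp
  then have "i - 1 \<le> count_below P' i" using active_row(5)[OF dom i] by simp
  moreover have "P' \<inter> {..<i} \<subseteq> {1..<i}" using dominatedD(3)[OF dom(2)] by auto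
  ultimately show ?thesis by (intro card_seteq) auto
qed

text \<open>Skipping \<open>i\<close> leaves \<open>P'\<close> at most \<open>m - 1\<close> entries
  up to \<open>m\<close>, which is the number of boxes of \<open>J\<close> there.\<close>

lemma tight_above_single_gap:
  assumes dom: "dominated n P' J" and i: "1 \<le> i" "i \<le> m" "i \<notin> P'"
    and J: "J \<inter> {..m} = {1..m} - {a}" "1 \<le> a" "a \<le> m"
  shows "count_below P' (Suc m) = count_below J (Suc m)"
proof -
  have "P' \<inter> {..<Suc m} \<subseteq> {1..m} - {i}" using dominatedD(3)[OF dom] i by auto
  then have "count_below P' (Suc m) \<le> card ({1..m} - {i})" by (rule card_mono[rotated]) simp
  moreover have "J \<inter> {..<Suc m} = {1..m} - {a}" using J by (simp add: lessThan_Suc_atMost)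
  ultimately show ?thesis using dominatedD(6)[OF dom, of "Suc m"] i J by simp
qed

text \<open>\<open>J\<close>, \<open>K\<close> stand for two columns of \<open>D\<close>;
  \<open>P\<close>, \<open>Q\<close> for those of \<open>C\<close>; \<open>P'\<close>,
  \<open>Q'\<close> for those of \<open>C'\<close>. The window serves an exchange in
  \<open>C'\<close>, the diagram whose entry \<open>i\<close> lies in the column that ends no later
  than the other.\<close>

lemma exchange_window:
  assumes av: "avoids J K" "avoids K J"
    and J: "dominated n P J" "dominated n P' J"
      "P \<inter> {..<i} = P' \<inter> {..<i}" "i \<in> P" "i \<notin> P'"
    and K: "dominated n Q K" "dominated n Q' K"
      "Q \<inter> {..<i} = Q' \<inter> {..<i}" "i \<notin> Q" "i \<in> Q'"
    and Max: "Max K \<le> Max J"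
  shows "\<exists>a b. a \<le> i \<and> i < b \<and> b \<le> Suc n \<and> J \<inter> {a..<b} = K \<inter> {a..<b} \<and>
    P' \<inter> {a..<i} = Q' \<inter> {a..<i} \<and>
    count_below P' a = count_below J a \<and> count_below Q' a = count_below K a \<and>
    count_below P' b = count_below J b \<and> count_below Q' b = count_below K b"
proof -
  \<comment> \<open>For column \<open>K\<close> the primed and unprimed sets change roles, so the
    lemmas on active rows speak about \<open>Q\<close>; agreement above row \<open>i\<close> carries
    their conclusions over to \<open>Q'\<close>.\<close>
  note K' = K(2,1) K(3)[symmetric] K(5,4)
  note actJ = active_row[OF J] and actK = active_row[OF K']
  note dJ = dominatedD[OF J(2)] and dK = dominatedD[OF K(2)]
  define m where "m = Max K"
  define e where "e = Max J"
  have m: "m \<in> K" "K \<subseteq> {..m}" "i < m"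
  proof -
    obtain p where p: "p \<in> K" "i < p" using actK(3) by blast
    show "m \<in> K" using Max_in[OF dK(2)] p by (auto simp: m_def)
    show "K \<subseteq> {..m}" using Max_ge[OF dK(2)] by (auto simp: m_def)
    show "i < m" using Max_ge[OF dK(2) p(1)] p(2) by (simp add: m_def)
  qed
  have e: "e \<in> J" "J \<subseteq> {..e}"
  proof -
    show "e \<in> J" using Max_in[OF dJ(2)] actJ(3) by (auto simp: e_def)
    show "J \<subseteq> {..e}" using Max_ge[OF dJ(2)] by (auto simp: e_def)
  qed
  obtain a where a: "a \<le> i" "1 \<le> a" "J \<inter> {a..m} = K \<inter> {a..m}"
    and low: "J \<inter> {..i} = {1..i} - {a} \<and> K \<inter> {..i} = {1..i} - {a} \<or>
      a = i \<and> K \<inter> {i..} = {m} \<and> (J \<inter> {i..} = {m} \<or> J \<inter> {..i} = {1..<i})"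
    and high: "J \<inter> {m..} = {m} \<or> J \<inter> {..m} = {1..m} - {a}"
    using common_window[OF av dJ(4) dK(4) actJ(2) actK(2) m(3,1,2) e(1) _ e(2)] Max
    unfolding m_def[symmetric] e_def[symmetric] by auto
  \<comment> \<open>The window ends with the last box \<open>m\<close> of \<open>K\<close>, so its
    exclusive bound is \<open>b = Suc m\<close>.\<close>
  have "count_below Q' (Suc m) = count_below K (Suc m)"
    using m by (intro tight_above[OF K(2)]) auto
  moreover have "count_below P' (Suc m) = count_below J (Suc m)"
    using high
  proof
    assume h: "J \<inter> {m..} = {m}"
    have "J \<subseteq> {..<Suc m}"
    proof
      fix r assume "r \<in> J"
      show "r \<in> {..<Suc m}"
      proof (rule ccontr)
        assume "r \<notin> {..<Suc m}"
        then have "r \<in> J \<inter> {m..}" "r \<noteq> m" using \<open>r \<in> J\<close> by auto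
        then show False using h by auto
      qed
    qed
    then show ?thesis by (rule tight_above[OF J(2)])
  next
    assume "J \<inter> {..m} = {1..m} - {a}"
    then show ?thesis
      using actJ(1) m a J(5) by (intro tight_above_single_gap[OF J(2)]) auto
  qed
  moreover have "count_below P' a = count_below J a \<and> count_below Q' a = count_below K a \<and>
    P' \<inter> {a..<i} = Q' \<inter> {a..<i}"
    using low
  proof (elim disjE conjE)
    assume g: "J \<inter> {..i} = {1..i} - {a}" "K \<inter> {..i} = {1..i} - {a}"
    have P: "P' \<inter> {..<i} = {1..<i}" using full_below_active_row[OF J g(1) a(2,1)] .
    have Q: "Q \<inter> {..<i} = {1..<i}" using full_below_active_row[OF K' g(2) a(2,1)] .
    have sub: "X \<inter> {..<a} = {1..<a}" if "X \<inter> {..<i} = {1..<i}" for X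
    proof -
      have "X \<inter> {..<a} = (X \<inter> {..<i}) \<inter> {..<a}" using a by auto
      also have "\<dots> = {1..<a}" using that a by auto
      finally show ?thesis .
    qed
    have sub2: "X \<inter> {..<a} = {1..<a}" if "X \<inter> {..i} = {1..i} - {a}" for X
    proof -
      have "X \<inter> {..<a} = (X \<inter> {..i}) \<inter> {..<a}" using a by auto
      also have "\<dots> = {1..<a}" using that a by auto
      finally show ?thesis .
    qed
    have "P' \<inter> {a..<i} = (P' \<inter> {..<i}) \<inter> {a..<i}" "Q' \<inter> {a..<i} = (Q' \<inter> {..<i}) \<inter> {a..<i}" by auto
    then have "P' \<inter> {a..<i} = Q' \<inter> {a..<i}" using P Q K(3) by simp
    then show ?thesis using sub[OF P] sub[of Q'] Q K(3) sub2 g by simp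
  next
    assume g: "a = i" "K \<inter> {i..} = {m}" "J \<inter> {i..} = {m}"
    then show ?thesis
      using tight_before_last_box[OF J g(3)] tight_before_last_box[OF K' g(2)] K(3) by simp
  next
    assume g: "a = i" "K \<inter> {i..} = {m}" "J \<inter> {..i} = {1..<i}"
    have "{1..<i} = {1..i} - {i}" by auto
    then have "P' \<inter> {..<i} = {1..<i}"
      using full_below_active_row[OF J, of i] g actJ(1) by simp
    moreover have "J \<inter> {..<i} = J \<inter> {..i} \<inter> {..<i}" by auto
    then have "J \<inter> {..<i} = {1..<i}" using g by auto
    ultimately show ?thesis
      using tight_before_last_box[OF K' g(2)] g K(3) by simp
  qed
  moreover have "J \<inter> {a..<Suc m} = K \<inter> {a..<Suc m}" using a by (simp add: atLeastLessThanSuc_atLeastAtMost)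
  moreover have "i < Suc m" "Suc m \<le> Suc n" using m dK by auto
  ultimately show ?thesis using a by blast
qed

section \<open>Exchanging columns in a window of rows\<close>

definition splice :: "nat \<Rightarrow> nat \<Rightarrow> nat set \<Rightarrow> nat set \<Rightarrow> nat set" where
  "splice a b X Y = X - {a..<b} \<union> Y \<inter> {a..<b}"

lemma count_below_splice:
  assumes fin: "finite X" "finite Y" and ab: "a \<le> b"
  shows "r \<le> a \<Longrightarrow> count_below (splice a b X Y) r = count_below X r"
    and "a \<le> r \<Longrightarrow> r \<le> b \<Longrightarrow> count_below (splice a b X Y) r = count_below X a + card (Y \<inter> {a..<r})"
    and "b \<le> r \<Longrightarrow> count_below (splice a b X Y) r =
      count_below X a + card (Y \<inter> {a..<b}) + card (X \<inter> {b..<r})"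
proof -
  have finS: "finite (splice a b X Y)" using fin by (simp add: splice_def)
  show low: "count_below (splice a b X Y) r = count_below X r" if "r \<le> a" for r
    by (rule arg_cong[where f = card]) (use that ab in \<open>auto simp: splice_def\<close>)
  show mid: "count_below (splice a b X Y) r = count_below X a + card (Y \<inter> {a..<r})"
    if "a \<le> r" "r \<le> b" for r
  proof -
    have "splice a b X Y \<inter> {a..<r} = Y \<inter> {a..<r}" using that by (auto simp: splice_def)
    then show ?thesis using count_below_split[OF finS that(1)] low[of a] by simp
  qed
  show "count_below (splice a b X Y) r =
      count_below X a + card (Y \<inter> {a..<b}) + card (X \<inter> {b..<r})" if "b \<le> r"
  proof -
    have "splice a b X Y \<inter> {b..<r} = X \<inter> {b..<r}" using that ab by (auto simp: splice_def)
    then show ?thesis using count_below_split[OF finS that] mid[of b] ab by simp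
  qed
qed

text \<open>Tightness at both ends and the agreement of \<open>J\<close> and \<open>K\<close> give
  \<open>P\<close> and \<open>Q\<close> equally many entries in the window. Hence counts change only
  inside it, and there being dominated by \<open>K\<close> amounts to being dominated by
  \<open>J\<close>.\<close>

lemma splice_dominated:
  assumes J: "dominated n P J" and K: "dominated n Q K" and ab: "a \<le> b" "b \<le> Suc n"
    and eq: "J \<inter> {a..<b} = K \<inter> {a..<b}"
    and tight: "count_below P a = count_below J a" "count_below Q a = count_below K a"
      "count_below P b = count_below J b" "count_below Q b = count_below K b"
  shows "dominated n (splice a b P Q) J"
    "count_below (splice a b P Q) a = count_below J a"
    "count_below (splice a b P Q) b = count_below J b"
proof -
  note dJ = dominatedD[OF J] and dK = dominatedD[OF K]
  note sp = count_below_splice[OF dJ(1) dK(1) ab(1)]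
  have window: "card (Q \<inter> {a..<b}) = card (P \<inter> {a..<b})"
    using count_below_split[OF dJ(1) ab(1)] count_below_split[OF dJ(2) ab(1)]
      count_below_split[OF dK(1) ab(1)] count_below_split[OF dK(2) ab(1)] eq tight by simp
  have above: "count_below (splice a b P Q) r = count_below P r" if "b \<le> r" for r
    using sp(3)[OF that] window count_below_split[OF dJ(1) that] count_below_split[OF dJ(1) ab(1)] by simp
  show "count_below (splice a b P Q) a = count_below J a"
    using sp(1)[of a] tight by simp
  show "count_below (splice a b P Q) b = count_below J b"
    using above[of b] tight by simp
  have sub: "splice a b P Q \<subseteq> {1..n}" using dJ(3) dK(3) by (auto simp: splice_def)
  have whole: "X \<inter> {..<Suc n} = X" if "X \<subseteq> {1..n}" for X using that by auto
  have "card (splice a b P Q) = card P"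
    using above[OF ab(2)] whole[OF sub] whole[OF dJ(3)] by simp
  moreover have "count_below J r \<le> count_below (splice a b P Q) r" for r
  proof -
    consider "r \<le> a" | "a \<le> r" "r \<le> b" | "b \<le> r" by linarith
    then show ?thesis
    proof cases
      case 1 then show ?thesis using sp(1) dJ(6)[of r] by simp
    next
      case 2
      have "J \<inter> {a..<r} = (J \<inter> {a..<b}) \<inter> {a..<r}" "K \<inter> {a..<r} = (K \<inter> {a..<b}) \<inter> {a..<r}"
        using 2 by auto
      then have "J \<inter> {a..<r} = K \<inter> {a..<r}" using eq by simp
      then show ?thesis
        using sp(2)[OF 2] count_below_split[OF dJ(2) 2(1)] count_below_split[OF dK(2) 2(1)]
          count_below_split[OF dK(1) 2(1)] dK(6)[of r] tight by simp
    next
      case 3 then show ?thesis using above dJ(6)[of r] by simp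
    qed
  qed
  ultimately show "dominated n (splice a b P Q) J"
    using sub dJ(4,5) by (simp add: dominated_def)
qed

section \<open>Exchanging cells between two columns of a diagram\<close>

definition swap_cell :: "nat \<Rightarrow> nat \<Rightarrow> nat \<Rightarrow> nat \<Rightarrow> nat \<times> nat \<Rightarrow> nat \<times> nat" where
  "swap_cell a b j k = (\<lambda>(r, c). (r, if r \<in> {a..<b} then transpose j k c else c))"

text \<open>Because the map is its own inverse, the preimage of a diagram under
  \<open>swap_cell\<close> is also its image, and exchanging twice restores it.\<close>

lemma swap_cell_involutory [simp]: "swap_cell a b j k (swap_cell a b j k x) = x"
  by (cases x) (simp add: swap_cell_def)

lemma column_swap_cell:
  assumes "j \<noteq> k"
  shows "column (swap_cell a b j k -` C) j = splice a b (column C j) (column C k)"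
    and "column (swap_cell a b j k -` C) k = splice a b (column C k) (column C j)"
    and "c \<noteq> j \<Longrightarrow> c \<noteq> k \<Longrightarrow> column (swap_cell a b j k -` C) c = column C c"
  using assms by (auto simp: column_def swap_cell_def splice_def split: if_splits)

text \<open>Agreement in the window is asked of \<open>D\<close> only, so that the exchange maps
  \<open>D\<close> to itself; the columns of \<open>C\<close> may differ there.\<close>

definition exchangeable ::
    "nat \<Rightarrow> (nat \<times> nat) set \<Rightarrow> (nat \<times> nat) set \<Rightarrow> nat \<Rightarrow> nat \<Rightarrow> nat \<Rightarrow> nat \<Rightarrow> bool" where
  "exchangeable n D C a b j k \<longleftrightarrow> j \<in> {1..n} \<and> k \<in> {1..n} \<and> j \<noteq> k \<and> a \<le> b \<and> b \<le> Suc n \<and>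
     column D j \<inter> {a..<b} = column D k \<inter> {a..<b} \<and>
     (\<forall>c \<in> {j, k}. count_below (column C c) a = count_below (column D c) a \<and>
        count_below (column C c) b = count_below (column D c) b)"

lemma swap_cell_mem_iff:
  assumes "exchangeable n D C a b j k"
  shows "swap_cell a b j k x \<in> D \<longleftrightarrow> x \<in> D"
proof (cases x)
  case (Pair r c)
  have "(r, j) \<in> D \<longleftrightarrow> (r, k) \<in> D" if "r \<in> {a..<b}"
    using assms that unfolding exchangeable_def column_def by blast
  then show ?thesis by (simp add: Pair swap_cell_def transpose_def)
qed

definition dominated_diagram :: "nat \<Rightarrow> (nat \<times> nat) set \<Rightarrow> (nat \<times> nat) set \<Rightarrow> bool" where
  "dominated_diagram n C D \<longleftrightarrow> diagram n C \<and> (\<forall>c \<in> {1..n}. dominated n (column C c) (column D c))"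

text \<open>The second conclusion lets the exchange be undone by the same lemmas.\<close>

lemma exchange_dominated:
  assumes C: "dominated_diagram n C D" and ex: "exchangeable n D C a b j k"
  shows "dominated_diagram n (swap_cell a b j k -` C) D"
    and "exchangeable n D (swap_cell a b j k -` C) a b j k"
proof -
  have jk: "j \<in> {1..n}" "k \<in> {1..n}" "j \<noteq> k" "a \<le> b" "b \<le> Suc n"
    and eq: "column D j \<inter> {a..<b} = column D k \<inter> {a..<b}"
    and tight: "count_below (column C j) a = count_below (column D j) a"
      "count_below (column C k) a = count_below (column D k) a"
      "count_below (column C j) b = count_below (column D j) b"
      "count_below (column C k) b = count_below (column D k) b"
    using ex by (auto simp: exchangeable_def)
  have dom: "dominated n (column C c) (column D c)" if "c \<in> {1..n}" for c
    using C that by (simp add: dominated_diagram_def)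
  note col = column_swap_cell[OF jk(3)]
  note sj = splice_dominated[OF dom[OF jk(1)] dom[OF jk(2)] jk(4,5) eq tight]
  note sk = splice_dominated[OF dom[OF jk(2)] dom[OF jk(1)] jk(4,5) eq[symmetric] tight(2,1,4,3)]
  have "diagram n (swap_cell a b j k -` C)"
  proof -
    have "x \<in> {1..n} \<times> {1..n}" if "swap_cell a b j k x \<in> C" for x
    proof -
      have "swap_cell a b j k x \<in> {1..n} \<times> {1..n}"
        using C that by (auto simp: dominated_diagram_def diagram_def)
      then show ?thesis using jk(1,2) by (cases x) (auto simp: swap_cell_def transpose_def split: if_splits)
    qed
    then show ?thesis unfolding diagram_def by blast
  qed
  moreover have "dominated n (column (swap_cell a b j k -` C) c) (column D c)" if "c \<in> {1..n}" for c
  proof -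
    consider "c = j" | "c = k" | "c \<noteq> j" "c \<noteq> k" by blast
    then show ?thesis using sj(1) sk(1) dom[OF that] col(1,2) col(3)[of c] by cases simp_all
  qed
  ultimately show "dominated_diagram n (swap_cell a b j k -` C) D"
    by (simp add: dominated_diagram_def)
  show "exchangeable n D (swap_cell a b j k -` C) a b j k"
    using jk eq sj(2,3) sk(2,3) col by (simp add: exchangeable_def)
qed

lemma card_row_swap_cell:
  "card {c. (r, c) \<in> swap_cell a b j k -` C} = card {c. (r, c) \<in> C}"
proof (rule bij_betw_same_card)
  show "bij_betw (\<lambda>c. snd (swap_cell a b j k (r, c))) {c. (r, c) \<in> swap_cell a b j k -` C} {c. (r, c) \<in> C}"
    by (rule bij_betw_byWitness[where f' = "\<lambda>c. snd (swap_cell a b j k (r, c))"])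
      (auto simp: swap_cell_def)
qed

text \<open>
  A column set that is tight at \<open>a\<close> forces the boxes above row \<open>a\<close> to use exactly the entries
  below \<open>a\<close>: these are distinct, smaller than \<open>a\<close>, and there are just enough of them.
\<close>

lemma entry_below_iff:
  assumes D: "diagram n D" and F: "F \<in> flagged_fillings_content n D C"
    and tight: "count_below (column C c) a = count_below (column D c) a"
    and rc: "(r, c) \<in> D"
  shows "F (r, c) < a \<longleftrightarrow> r < a"
proof -
  let ?J = "column D c" and ?P = "column C c" and ?f = "\<lambda>r. F (r, c)"
  have c: "c \<in> {1..n}" using D rc by (auto simp: diagram_def)
  have F': "F \<in> Pi\<^sub>E D (\<lambda>(i, j). {1..i})" "inj_on ?f ?J" "?f ` ?J = ?P"
    using F c by (auto simp: flagged_fillings_content_def flagged_fillings_def)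
  have le: "?f q \<le> q" if "q \<in> ?J" for q
    using PiE_mem[OF F'(1), of "(q, c)"] that by (simp add: column_def)
  have fin: "finite ?J"
    by (rule finite_subset[of _ "{1..n}"]) (use D in \<open>auto simp: diagram_def column_def\<close>)
  have "?f ` (?J \<inter> {..<a}) = ?P \<inter> {..<a}"
  proof (rule card_subset_eq)
    show "finite (?P \<inter> {..<a})" by simp
    show "?f ` (?J \<inter> {..<a}) \<subseteq> ?P \<inter> {..<a}" using F'(3) le by (auto intro: le_less_trans)
    have "inj_on ?f (?J \<inter> {..<a})" using F'(2) by (rule inj_on_subset) simp
    then show "card (?f ` (?J \<inter> {..<a})) = card (?P \<inter> {..<a})"
      using tight by (simp add: card_image)
  qed
  then have "?f r \<in> ?f ` (?J \<inter> {..<a}) \<longleftrightarrow> ?f r < a"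
    using rc F'(3) by (auto simp: column_def)
  moreover have "?f r \<in> ?f ` (?J \<inter> {..<a}) \<longleftrightarrow> r \<in> ?J \<inter> {..<a}"
    using rc F'(2) by (intro inj_on_image_mem_iff) (auto simp: column_def)
  ultimately show ?thesis using rc by (auto simp: column_def)
qed

text \<open>Listing inversions by column and rows instead of word positions allows fillings to be
  compared by a bijection that moves inversions between columns.\<close>

lemma filling_inv_eq_card:
  assumes "diagram n D"
  shows "filling_inv n D F =
    card {(c, r, s). (r, c) \<in> D \<and> (s, c) \<in> D \<and> r < s \<and> F (s, c) < F (r, c)}"
proof -
  let ?I = "\<lambda>c. {(r, s). (r, c) \<in> D \<and> (s, c) \<in> D \<and> r < s \<and> F (s, c) < F (r, c)}"
  have fin: "finite (column D c)" for c
    by (rule finite_subset[of _ "{1..n}"]) (use assms in \<open>auto simp: diagram_def column_def\<close>)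
  have finI: "finite (?I c)" for c
    by (rule finite_subset[OF _ finite_cartesian_product[OF fin fin]]) (auto simp: column_def)
  have "inversions (column_word D F c) = card (?I c)" for c
  proof -
    let ?l = "sorted_list_of_set (column D c)"
    have mono: "?l ! p < ?l ! q \<longleftrightarrow> p < q" if "p < length ?l" "q < length ?l" for p q
    proof -
      have "?l ! u < ?l ! v" if "u < v" "v < length ?l" for u v
        using sorted_wrt_nth_less[OF strict_sorted_list_of_set] that by blast
      from this[of p q] this[of q p] show ?thesis using that by (cases p q rule: linorder_cases) auto
    qed
    have "bij_betw (\<lambda>(p, q). (?l ! p, ?l ! q))
      {(p, q). p < q \<and> q < length (column_word D F c) \<and> column_word D F c ! p > column_word D F c ! q}
      (?I c)"
    proof (rule bij_betw_imageI)
      show "inj_on (\<lambda>(p, q). (?l ! p, ?l ! q))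
        {(p, q). p < q \<and> q < length (column_word D F c) \<and> column_word D F c ! p > column_word D F c ! q}"
        by (auto simp: inj_on_def column_word_def nth_eq_iff_index_eq)
      show "(\<lambda>(p, q). (?l ! p, ?l ! q)) `
        {(p, q). p < q \<and> q < length (column_word D F c) \<and> column_word D F c ! p > column_word D F c ! q}
        = ?I c"
      proof (intro set_eqI iffI)
        fix x assume "x \<in> ?I c"
        then obtain r s where x: "x = (r, s)" "r \<in> set ?l" "s \<in> set ?l" "r < s" "F (s, c) < F (r, c)"
          using fin by (auto simp: column_def)
        then obtain p q where pq: "p < length ?l" "q < length ?l" "r = ?l ! p" "s = ?l ! q"
          by (metis in_set_conv_nth)
        then have "p < q" using mono x(4) by simp
        then show "x \<in> (\<lambda>(p, q). (?l ! p, ?l ! q)) `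
          {(p, q). p < q \<and> q < length (column_word D F c) \<and> column_word D F c ! p > column_word D F c ! q}"
          using x pq by (intro image_eqI[of _ _ "(p, q)"]) (auto simp: column_word_def)
      next
        fix x assume "x \<in> (\<lambda>(p, q). (?l ! p, ?l ! q)) `
          {(p, q). p < q \<and> q < length (column_word D F c) \<and> column_word D F c ! p > column_word D F c ! q}"
        then obtain p q where pq: "x = (?l ! p, ?l ! q)" "p < q" "q < length ?l"
          "F (?l ! q, c) < F (?l ! p, c)"
          by (auto simp: column_word_def)
        have "?l ! p \<in> column D c" "?l ! q \<in> column D c"
          using pq nth_mem[of _ ?l] fin by (metis less_trans set_sorted_list_of_set)+
        then show "x \<in> ?I c" using pq mono by (auto simp: column_def)
      qed
    qed
    then show ?thesis unfolding inversions_def by (rule bij_betw_same_card)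
  qed
  then have "filling_inv n D F = card (Sigma {1..n} ?I)"
    by (simp add: filling_inv_def card_SigmaI finI)
  also have "Sigma {1..n} ?I = {(c, r, s). (r, c) \<in> D \<and> (s, c) \<in> D \<and> r < s \<and> F (s, c) < F (r, c)}"
    using assms by (auto simp: diagram_def)
  finally show ?thesis .
qed

section \<open>Content, inversions and weight of an exchanged filling\<close>

text \<open>\<open>restrict\<close> keeps the value \<open>undefined\<close> off \<open>D\<close>,
  as membership in \<open>flagged_fillings\<close> demands.\<close>

definition swap_filling :: "(nat \<times> nat) set \<Rightarrow> nat \<Rightarrow> nat \<Rightarrow> nat \<Rightarrow> nat \<Rightarrow> (nat \<times> nat \<Rightarrow> nat) \<Rightarrow> nat \<times> nat \<Rightarrow> nat" where
  "swap_filling D a b j k F = restrict (F \<circ> swap_cell a b j k) D"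

context
  fixes n D C a b j k
  assumes D: "diagram n D" and ex: "exchangeable n D C a b j k"
begin

private definition swap_col where "swap_col r c = (if r \<in> {a..<b} then transpose j k c else c)"

private lemma swap_cell_eq: "swap_cell a b j k (r, c) = (r, swap_col r c)"
  by (simp add: swap_cell_def swap_col_def)

private lemma swap_col_swap_col [simp]: "swap_col r (swap_col r c) = c"
  by (simp add: swap_col_def)

private lemma swap_col_mem: "(r, swap_col r c) \<in> D \<longleftrightarrow> (r, c) \<in> D"
  using swap_cell_mem_iff[OF ex, of "(r, c)"] by (simp add: swap_cell_eq)

private lemma swap_col_other: "c \<noteq> j \<Longrightarrow> c \<noteq> k \<Longrightarrow> swap_col r c = c"
  by (simp add: swap_col_def)

private lemma window_iff:
  assumes "F \<in> flagged_fillings_content n D C" "(r, c) \<in> D" "c \<in> {j, k}"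
  shows "F (r, c) < a \<longleftrightarrow> r < a" "F (r, c) < b \<longleftrightarrow> r < b"
  using entry_below_iff[OF D assms(1) _ assms(2)] ex assms(3) unfolding exchangeable_def by blast+

text \<open>By tightness at both ends, an entry in column \<open>j\<close> or \<open>k\<close> lies
  in the window exactly when its row does. So exchanging boxes by row also exchanges entries by
  value, which is why the content undergoes the same exchange.\<close>

private lemma swap_col_entry:
  assumes "F \<in> flagged_fillings_content n D C" "(r, c) \<in> D"
  shows "swap_col (F (r, c)) c = swap_col r c"
  using window_iff[OF assms] swap_col_other[of c] by (cases "c \<in> {j, k}") (auto simp: swap_col_def not_less[symmetric])

private lemma swap_col_swapped_entry:
  assumes "F \<in> flagged_fillings_content n D C" "(r, c) \<in> D"
  shows "swap_col (F (r, swap_col r c)) c = swap_col r c"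
  using swap_col_entry[OF assms(1), of r "swap_col r c"] assms(2) swap_col_mem swap_col_swap_col by metis

lemma swap_filling_content:
  assumes F: "F \<in> flagged_fillings_content n D C"
  shows "swap_filling D a b j k F \<in> flagged_fillings_content n D (swap_cell a b j k -` C)"
proof -
  have F': "F \<in> Pi\<^sub>E D (\<lambda>(i, j). {1..i})" "\<And>c. inj_on (\<lambda>r. F (r, c)) (column D c)"
    "\<And>c. c \<in> {1..n} \<Longrightarrow> (\<lambda>r. F (r, c)) ` column D c = column C c"
    using F by (auto simp: flagged_fillings_content_def flagged_fillings_def)
  have val: "swap_filling D a b j k F (r, c) = F (r, swap_col r c)" if "(r, c) \<in> D" for r c
    using that by (simp add: swap_filling_def swap_cell_eq)
  have "swap_filling D a b j k F (r, c) \<in> {1..r}" if "(r, c) \<in> D" for r c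
    using PiE_mem[OF F'(1), of "(r, swap_col r c)"] that swap_col_mem val by simp
  then have "swap_filling D a b j k F \<in> Pi\<^sub>E D (\<lambda>(i, j). {1..i})"
    by (intro PiE_I) (auto simp: swap_filling_def)
  moreover have "inj_on (\<lambda>r. swap_filling D a b j k F (r, c)) (column D c)" for c
  proof (rule inj_onI)
    fix r s assume rs: "r \<in> column D c" "s \<in> column D c"
      "swap_filling D a b j k F (r, c) = swap_filling D a b j k F (s, c)"
    then have mem: "(r, c) \<in> D" "(s, c) \<in> D" and eq: "F (r, swap_col r c) = F (s, swap_col s c)"
      by (auto simp: column_def val)
    \<comment> \<open>Equal entries are moved alike, so both come from one column of
      \<open>F\<close>, where \<open>F\<close> is injective.\<close>
    have "swap_col r c = swap_col s c" using swap_col_swapped_entry[OF F mem(1)]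
        swap_col_swapped_entry[OF F mem(2)] eq by metis
    moreover have "r \<in> column D (swap_col r c)" "s \<in> column D (swap_col s c)" using mem swap_col_mem by (auto simp: column_def)
    ultimately show "r = s" using F'(2)[of "swap_col r c"] eq by (auto dest: inj_onD)
  qed
  moreover have "(\<lambda>r. swap_filling D a b j k F (r, c)) ` column D c = column (swap_cell a b j k -` C) c"
    if c: "c \<in> {1..n}" for c
  proof -
    have tc: "swap_col r c \<in> {1..n}" for r
      using c ex by (auto simp: swap_col_def exchangeable_def transpose_def)
    have "(\<lambda>r. swap_filling D a b j k F (r, c)) ` column D c = (\<lambda>r. F (r, swap_col r c)) ` column D c"
      by (rule image_cong) (auto simp: val column_def)
    also have "\<dots> = {v. (v, swap_col v c) \<in> C}"
    proof (intro set_eqI iffI)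
      fix v assume "v \<in> (\<lambda>r. F (r, swap_col r c)) ` column D c"
      then obtain r where r: "(r, c) \<in> D" "v = F (r, swap_col r c)" by (auto simp: column_def)
      then have "v \<in> column C (swap_col r c)"
        using F'(3)[OF tc, of r] swap_col_mem[of r c] by (auto simp: column_def)
      then show "v \<in> {v. (v, swap_col v c) \<in> C}"
        using swap_col_swapped_entry[OF F r(1)] r(2) by (simp add: column_def)
    next
      fix v assume "v \<in> {v. (v, swap_col v c) \<in> C}"
      then have "v \<in> column C (swap_col v c)" by (simp add: column_def)
      then obtain r where r: "(r, swap_col v c) \<in> D" "v = F (r, swap_col v c)"
        using F'(3)[OF tc, of v] by (auto simp: column_def)
      have "swap_col r (swap_col v c) = c" using swap_col_entry[OF F r(1)] r(2) by simp
      then have eq: "swap_col r c = swap_col v c" by (metis swap_col_swap_col)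
      show "v \<in> (\<lambda>r. F (r, swap_col r c)) ` column D c"
      proof (rule image_eqI)
        show "v = F (r, swap_col r c)" unfolding eq by (rule r(2))
        show "r \<in> column D c" using r(1) swap_col_mem[of r c] unfolding eq by (simp add: column_def)
      qed
    qed
    finally show ?thesis by (simp add: column_def swap_cell_eq)
  qed
  ultimately show ?thesis
    by (simp add: flagged_fillings_content_def flagged_fillings_def)
qed

lemma swap_filling_inv:
  assumes F: "F \<in> flagged_fillings_content n D C"
  shows "filling_inv n D (swap_filling D a b j k F) = filling_inv n D F"
proof -
  let ?F' = "swap_filling D a b j k F"
  let ?I = "\<lambda>F. {(c, r, s). (r, c) \<in> D \<and> (s, c) \<in> D \<and> r < s \<and> F (s, c) < F (r, c)}"
  have val: "?F' (r, c) = F (r, swap_col r c)" if "(r, c) \<in> D" for r c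
    using that by (simp add: swap_filling_def swap_cell_eq)
  have le: "F (r, c) \<le> r" if "(r, c) \<in> D" for r c
  proof -
    have "F \<in> Pi\<^sub>E D (\<lambda>(i, j). {1..i})"
      using F by (simp add: flagged_fillings_content_def flagged_fillings_def)
    from PiE_mem[OF this that] show ?thesis by simp
  qed
  \<comment> \<open>An end of the window separating the rows \<open>r < s\<close> would separate
    their entries in the same order, so no inversion straddles it. The columns \<open>c\<close>,
    \<open>d\<close> are kept apart because the two boxes of an inversion of the exchanged filling
    are not yet known to come from one column of \<open>F\<close>.\<close>
  have same: "swap_col r c' = swap_col s c'"
    if "(r, c) \<in> D" "(s, d) \<in> D" "r < s" "F (s, d) < F (r, c)" "c \<in> {j, k}" "d \<in> {j, k}" for r s c d c'
    using window_iff[OF F that(1,5)] window_iff[OF F that(2,6)] le[OF that(1)] that(3,4)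
    by (auto simp: swap_col_def)
  have other: "swap_col r c = swap_col s c" if "c \<notin> {j, k}" for r s c
    using that swap_col_other by simp
  have tjk: "swap_col r c \<in> {j, k} \<longleftrightarrow> c \<in> {j, k}" for r c
    by (auto simp: swap_col_def transpose_def)
  have bwd: "(swap_col r c, r, s) \<in> ?I ?F'" "swap_col r c = swap_col s c" if "(c, r, s) \<in> ?I F" for c r s
  proof -
    have m: "(r, c) \<in> D" "(s, c) \<in> D" "r < s" "F (s, c) < F (r, c)" using that by auto
    show eq: "swap_col r c = swap_col s c" using same[OF m] other by (cases "c \<in> {j, k}") auto
    then show "(swap_col r c, r, s) \<in> ?I ?F'"
      using m swap_col_mem[of r c] swap_col_mem[of s c] val[of r "swap_col r c"] val[of s "swap_col s c"]
        swap_col_swap_col[of r c] swap_col_swap_col[of s c]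
      by auto
  qed
  have fwd: "(swap_col r c, r, s) \<in> ?I F" "swap_col r c = swap_col s c" if "(c, r, s) \<in> ?I ?F'" for c r s
  proof -
    have m: "(r, swap_col r c) \<in> D" "(s, swap_col s c) \<in> D" "r < s" "F (s, swap_col s c) < F (r, swap_col r c)"
      using that val swap_col_mem by auto
    show eq: "swap_col r c = swap_col s c" using same[OF m] other tjk by (cases "c \<in> {j, k}") auto
    then show "(swap_col r c, r, s) \<in> ?I F" using m by simp
  qed
  have "bij_betw (\<lambda>(c, r, s). (swap_col r c, r, s)) (?I ?F') (?I F)"
  proof (rule bij_betw_byWitness[where f' = "\<lambda>(c, r, s). (swap_col r c, r, s)"])
    show "(\<lambda>(c, r, s). (swap_col r c, r, s)) ` ?I ?F' \<subseteq> ?I F" using fwd(1) by auto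
    show "(\<lambda>(c, r, s). (swap_col r c, r, s)) ` ?I F \<subseteq> ?I ?F'" using bwd(1) by auto
  qed auto
  then show ?thesis unfolding filling_inv_eq_card[OF D] by (rule bij_betw_same_card)
qed

text \<open>Entries move within their rows, so the factors are merely permuted.\<close>

lemma swap_filling_y_monomial: "y_monomial D (swap_filling D a b j k F) = y_monomial D F"
  unfolding y_monomial_def
proof (rule prod.reindex_bij_witness[where i = "swap_cell a b j k" and j = "swap_cell a b j k"])
  fix x assume "x \<in> D"
  then show "(case swap_cell a b j k x of (i, j) \<Rightarrow> indet (F (i, j), i)) =
      (case x of (i, ja) \<Rightarrow> indet (swap_filling D a b j k F (i, ja), i))"
    by (cases x) (simp add: swap_filling_def swap_cell_eq)
qed (simp_all add: swap_cell_mem_iff[OF ex])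

text \<open>The content \<open>C'\<close> is arbitrary, so that this serves fillings of the original
  and of the exchanged content.\<close>

lemma swap_filling_involutory:
  assumes F: "F \<in> flagged_fillings_content n D C'"
  shows "swap_filling D a b j k (swap_filling D a b j k F) = F"
proof
  fix x
  have "F \<in> Pi\<^sub>E D (\<lambda>(i, j). {1..i})"
    using F by (simp add: flagged_fillings_content_def flagged_fillings_def)
  then show "swap_filling D a b j k (swap_filling D a b j k F) x = F x"
    using swap_cell_mem_iff[OF ex, of x] PiE_arb[of F D _ x] by (auto simp: swap_filling_def)
qed

end

section \<open>Connecting diagrams by exchanges\<close>

text \<open>The conclusion of the theorem as a relation between contents, to be composed along a
  chain of exchanges.\<close>

definition equidistributed :: "nat \<Rightarrow> (nat \<times> nat) set \<Rightarrow> (nat \<times> nat) set \<Rightarrow> (nat \<times> nat) set \<Rightarrow> bool" where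
  "equidistributed n D C C' \<longleftrightarrow>
     (\<exists>\<Omega>. bij_betw \<Omega> (flagged_fillings_content n D C) (flagged_fillings_content n D C') \<and>
        (\<forall>F \<in> flagged_fillings_content n D C.
           filling_sgn n D (\<Omega> F) = filling_sgn n D F \<and> y_monomial D (\<Omega> F) = y_monomial D F))"

lemma equidistributed_refl: "equidistributed n D C C"
  unfolding equidistributed_def by (rule exI[of _ id]) simp

lemma equidistributed_trans:
  assumes "equidistributed n D C C'" "equidistributed n D C' C''"
  shows "equidistributed n D C C''"
proof -
  obtain f where f: "bij_betw f (flagged_fillings_content n D C) (flagged_fillings_content n D C')"
    "\<forall>F \<in> flagged_fillings_content n D C.
       filling_sgn n D (f F) = filling_sgn n D F \<and> y_monomial D (f F) = y_monomial D F"
    using assms(1) unfolding equidistributed_def by blast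
  obtain g where g: "bij_betw g (flagged_fillings_content n D C') (flagged_fillings_content n D C'')"
    "\<forall>F \<in> flagged_fillings_content n D C'.
       filling_sgn n D (g F) = filling_sgn n D F \<and> y_monomial D (g F) = y_monomial D F"
    using assms(2) unfolding equidistributed_def by blast
  show ?thesis
    unfolding equidistributed_def
  proof (intro exI conjI ballI)
    show "bij_betw (g \<circ> f) (flagged_fillings_content n D C) (flagged_fillings_content n D C'')"
      using f(1) g(1) by (rule bij_betw_trans)
    fix F assume F: "F \<in> flagged_fillings_content n D C"
    then have "f F \<in> flagged_fillings_content n D C'" using f(1) by (rule bij_betwE[rule_format, rotated])
    then show "filling_sgn n D ((g \<circ> f) F) = filling_sgn n D F"
      "y_monomial D ((g \<circ> f) F) = y_monomial D F"
      using F f(2) g(2) by simp_all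
  qed
qed

lemma exchange_equidistributed:
  assumes D: "diagram n D" and ex: "exchangeable n D C a b j k"
    and ex': "exchangeable n D (swap_cell a b j k -` C) a b j k"
  shows "equidistributed n D C (swap_cell a b j k -` C)"
  unfolding equidistributed_def
proof (intro exI conjI ballI)
  let ?f = "swap_filling D a b j k"
  have twice: "swap_cell a b j k -` swap_cell a b j k -` C = C" by (simp add: set_eq_iff)
  show "bij_betw ?f (flagged_fillings_content n D C)
    (flagged_fillings_content n D (swap_cell a b j k -` C))"
  proof (rule bij_betw_byWitness[where f' = ?f])
    show "\<forall>F \<in> flagged_fillings_content n D C. ?f (?f F) = F"
      "\<forall>F \<in> flagged_fillings_content n D (swap_cell a b j k -` C). ?f (?f F) = F"
      by (intro ballI swap_filling_involutory[OF D ex], assumption)+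
    show "?f ` flagged_fillings_content n D C \<subseteq> flagged_fillings_content n D (swap_cell a b j k -` C)"
      using swap_filling_content[OF D ex] by (rule image_subsetI)
    show "?f ` flagged_fillings_content n D (swap_cell a b j k -` C) \<subseteq> flagged_fillings_content n D C"
      using swap_filling_content[OF D ex'] unfolding twice by (rule image_subsetI)
  qed
  fix F assume F: "F \<in> flagged_fillings_content n D C"
  show "filling_sgn n D (?f F) = filling_sgn n D F"
    using swap_filling_inv[OF D ex F] by (simp add: filling_sgn_def)
  show "y_monomial D (?f F) = y_monomial D F"
    by (rule swap_filling_y_monomial[OF D ex])
qed

text \<open>Rows above \<open>i\<close> are unchanged because the two columns of \<open>C\<close>
  agree between \<open>a\<close> and \<open>i\<close>. Equidistribution is recorded in both
  directions, since the chain may be extended at either end.\<close>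

lemma exchange_step:
  assumes D: "diagram n D" and C: "dominated_diagram n C D"
    and ex: "exchangeable n D C a b j k" and i: "a \<le> i" "i < b"
    and agree: "column C j \<inter> {a..<i} = column C k \<inter> {a..<i}"
    and jk: "(i, j) \<notin> C" "(i, k) \<in> C"
  shows "\<exists>C1. dominated_diagram n C1 D \<and> equidistributed n D C C1 \<and> equidistributed n D C1 C \<and>
    (\<forall>r. card {c. (r, c) \<in> C1} = card {c. (r, c) \<in> C}) \<and>
    (\<forall>r < i. \<forall>c. (r, c) \<in> C1 \<longleftrightarrow> (r, c) \<in> C) \<and>
    (i, j) \<in> C1 \<and> (i, k) \<notin> C1 \<and> (\<forall>c. c \<noteq> j \<longrightarrow> c \<noteq> k \<longrightarrow> (i, c) \<in> C1 \<longleftrightarrow> (i, c) \<in> C)"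
proof (intro exI conjI allI impI)
  let ?C1 = "swap_cell a b j k -` C"
  have twice: "swap_cell a b j k -` ?C1 = C" by (simp add: set_eq_iff)
  note ex1 = exchange_dominated[OF C ex]
  show "dominated_diagram n ?C1 D" by (rule ex1(1))
  show "equidistributed n D C ?C1" by (rule exchange_equidistributed[OF D ex ex1(2)])
  show "equidistributed n D ?C1 C"
    using exchange_equidistributed[OF D ex1(2)] ex unfolding twice .
  show "card {c. (r, c) \<in> ?C1} = card {c. (r, c) \<in> C}" for r by (rule card_row_swap_cell)
  show "(r, c) \<in> ?C1 \<longleftrightarrow> (r, c) \<in> C" if "r < i" for r c
  proof (cases "a \<le> r")
    case True
    have "r \<in> column C j \<inter> {a..<i} \<longleftrightarrow> r \<in> column C k \<inter> {a..<i}" using agree by simp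
    then have "(r, j) \<in> C \<longleftrightarrow> (r, k) \<in> C" using True that by (simp add: column_def)
    then show ?thesis by (simp add: swap_cell_def transpose_def)
  next
    case False then show ?thesis by (simp add: swap_cell_def)
  qed
  show "(i, j) \<in> ?C1" "(i, k) \<notin> ?C1"
    using i jk by (simp_all add: swap_cell_def)
  show "(i, c) \<in> ?C1 \<longleftrightarrow> (i, c) \<in> C" if "c \<noteq> j" "c \<noteq> k" for c
    using that by (simp add: swap_cell_def)
qed

text \<open>The step moves \<open>C'\<close> towards \<open>C\<close>: in row \<open>i\<close>,
  columns \<open>j\<close> and \<open>k\<close> now agree with \<open>C\<close>, while the other
  columns of row \<open>i\<close> and all rows above are untouched.\<close>

lemma exchange_exists:
  assumes D: "diagram n D" "multiplicity_free n D"
    and dom: "dominated_diagram n C D" "dominated_diagram n C' D"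
    and below: "\<forall>r < i. \<forall>c. (r, c) \<in> C \<longleftrightarrow> (r, c) \<in> C'"
    and jk: "(i, j) \<in> C" "(i, j) \<notin> C'" "(i, k) \<notin> C" "(i, k) \<in> C'"
    and Max: "Max (column D k) \<le> Max (column D j)"
  shows "\<exists>C1. dominated_diagram n C1 D \<and> equidistributed n D C' C1 \<and> equidistributed n D C1 C' \<and>
    (\<forall>r. card {c. (r, c) \<in> C1} = card {c. (r, c) \<in> C'}) \<and>
    (\<forall>r < i. \<forall>c. (r, c) \<in> C1 \<longleftrightarrow> (r, c) \<in> C') \<and>
    (i, j) \<in> C1 \<and> (i, k) \<notin> C1 \<and> (\<forall>c. c \<noteq> j \<longrightarrow> c \<noteq> k \<longrightarrow> (i, c) \<in> C1 \<longleftrightarrow> (i, c) \<in> C')"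
proof -
  have j: "j \<in> {1..n}" and k: "k \<in> {1..n}" and ne: "j \<noteq> k"
    using jk dom by (auto simp: dominated_diagram_def diagram_def)
  have cols: "column C c \<inter> {..<i} = column C' c \<inter> {..<i}" for c
    using below by (auto simp: column_def)
  have doms: "dominated n (column C c) (column D c)" "dominated n (column C' c) (column D c)"
    if "c \<in> {1..n}" for c
    using dom that by (simp_all add: dominated_diagram_def)
  have mem: "i \<in> column C j" "i \<notin> column C' j" "i \<notin> column C k" "i \<in> column C' k"
    using jk by (simp_all add: column_def)
  obtain a b where ab: "a \<le> i" "i < b" "b \<le> Suc n"
    "column D j \<inter> {a..<b} = column D k \<inter> {a..<b}"
    "column C' j \<inter> {a..<i} = column C' k \<inter> {a..<i}"
    "count_below (column C' j) a = count_below (column D j) a"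
    "count_below (column C' k) a = count_below (column D k) a"
    "count_below (column C' j) b = count_below (column D j) b"
    "count_below (column C' k) b = count_below (column D k) b"
    using exchange_window[OF avoids_if_multiplicity_free[OF D j k ne]
        avoids_if_multiplicity_free[OF D k j ne[symmetric]] doms(1)[OF j] doms(2)[OF j] cols mem(1,2)
        doms(1)[OF k] doms(2)[OF k] cols mem(3,4) Max]
    by (elim exE conjE)
  have "exchangeable n D C' a b j k"
    using ab j k ne by (simp add: exchangeable_def)
  from exchange_step[OF D(1) dom(2) this ab(1,2,5) jk(2,4)] show ?thesis .
qed

text \<open>Rows are settled from the top: the outer induction runs over the rows still to be
  compared, the inner one over the number of columns in which row \<open>i\<close> differs.\<close>

lemma equidistributed_if_rows_agree:
  assumes D: "diagram n D" "multiplicity_free n D"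
    and dom: "dominated_diagram n C D" "dominated_diagram n C' D"
    and rows: "\<forall>r. card {c. (r, c) \<in> C} = card {c. (r, c) \<in> C'}"
    and below: "\<forall>r < i. \<forall>c. (r, c) \<in> C \<longleftrightarrow> (r, c) \<in> C'"
  shows "equidistributed n D C C'"
  using dom rows below
proof (induction "Suc n - i" arbitrary: i C C')
  case 0
  have "r < i" if "(r, c) \<in> C \<or> (r, c) \<in> C'" for r c
    using that 0 by (auto simp: dominated_diagram_def diagram_def)
  then have "C = C'" using "0.prems"(4) by (simp add: set_eq_iff) blast
  then show ?case by (simp add: equidistributed_refl)
next
  case (Suc d)
  note outer = Suc.hyps(1)[of "Suc i"]
  have d: "d = Suc n - Suc i" using Suc.hyps(2) by simp
  show ?case
    using Suc.prems
  proof (induction "card {c. (i, c) \<in> C \<longleftrightarrow> (i, c) \<notin> C'}" arbitrary: C C' rule: less_induct)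
    case less
    let ?diff = "\<lambda>C C'. {c. (i, c) \<in> C \<longleftrightarrow> (i, c) \<notin> C'}"
    have fin: "finite {c. (i, c) \<in> E}" if "dominated_diagram n E D" for E
      by (rule finite_subset[of _ "{1..n}"]) (use that in \<open>auto simp: dominated_diagram_def diagram_def\<close>)
    have fin_diff: "finite (?diff C C')"
      by (rule finite_subset[of _ "{c. (i, c) \<in> C} \<union> {c. (i, c) \<in> C'}"])
        (use fin less.prems(1,2) in auto)
    show ?case
    proof (cases "{c. (i, c) \<in> C} = {c. (i, c) \<in> C'}")
      case True
      then have "\<forall>r < Suc i. \<forall>c. (r, c) \<in> C \<longleftrightarrow> (r, c) \<in> C'"
        using less.prems(4) by (auto simp: less_Suc_eq)
      then show ?thesis using outer[OF d less.prems(1-3)] by blast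
    next
      case False
      let ?A = "{c. (i, c) \<in> C}" and ?B = "{c. (i, c) \<in> C'}"
      \<comment> \<open>Equal row sizes turn a difference in row \<open>i\<close> into one in each
        direction.\<close>
      have "\<not> ?A \<subseteq> ?B" "\<not> ?B \<subseteq> ?A"
        using False less.prems(3) card_subset_eq[OF fin[OF less.prems(2)], of ?A]
          card_subset_eq[OF fin[OF less.prems(1)], of ?B] by auto
      then obtain j k where jk: "(i, j) \<in> C" "(i, j) \<notin> C'" "(i, k) \<notin> C" "(i, k) \<in> C'" by blast
      show ?thesis
      \<comment> \<open>The column that ends first decides which diagram is modified; either way
        \<open>j\<close> and \<open>k\<close> leave the set of differences.\<close>
      proof (cases "Max (column D k) \<le> Max (column D j)")
        case True
        obtain C1 where C1: "dominated_diagram n C1 D" "equidistributed n D C1 C'"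
          "\<forall>r. card {c. (r, c) \<in> C1} = card {c. (r, c) \<in> C'}"
          "\<forall>r < i. \<forall>c. (r, c) \<in> C1 \<longleftrightarrow> (r, c) \<in> C'"
          "(i, j) \<in> C1" "(i, k) \<notin> C1" "\<forall>c. c \<noteq> j \<longrightarrow> c \<noteq> k \<longrightarrow> (i, c) \<in> C1 \<longleftrightarrow> (i, c) \<in> C'"
          using exchange_exists[OF D less.prems(1,2,4) jk True] by blast
        have "?diff C C1 \<subset> ?diff C C'"
        proof (rule psubsetI)
          show "?diff C C1 \<subseteq> ?diff C C'"
          proof
            fix c assume c: "c \<in> ?diff C C1"
            then have "c \<noteq> j" "c \<noteq> k" using C1(5,6) jk(1,3) by auto
            then show "c \<in> ?diff C C'" using c C1(7) by simp
          qed
          have "j \<notin> ?diff C C1" "j \<in> ?diff C C'" using C1(5) jk(1,2) by simp_all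
          then show "?diff C C1 \<noteq> ?diff C C'" by metis
        qed
        then have "card (?diff C C1) < card (?diff C C')" by (rule psubset_card_mono[OF fin_diff])
        then have "equidistributed n D C C1"
          using less.hyps[OF _ less.prems(1) C1(1)] C1(3,4) less.prems(3,4) by simp
        then show ?thesis using C1(2) equidistributed_trans by blast
      next
        case False
        then have Max: "Max (column D j) \<le> Max (column D k)" by simp
        have below: "\<forall>r < i. \<forall>c. (r, c) \<in> C' \<longleftrightarrow> (r, c) \<in> C" using less.prems(4) by simp
        obtain C1 where C1: "dominated_diagram n C1 D" "equidistributed n D C C1"
          "\<forall>r. card {c. (r, c) \<in> C1} = card {c. (r, c) \<in> C}"
          "\<forall>r < i. \<forall>c. (r, c) \<in> C1 \<longleftrightarrow> (r, c) \<in> C"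
          "(i, k) \<in> C1" "(i, j) \<notin> C1" "\<forall>c. c \<noteq> k \<longrightarrow> c \<noteq> j \<longrightarrow> (i, c) \<in> C1 \<longleftrightarrow> (i, c) \<in> C"
          using exchange_exists[OF D less.prems(2,1) below jk(4,3,2,1) Max] by blast
        have "?diff C1 C' \<subset> ?diff C C'"
        proof (rule psubsetI)
          show "?diff C1 C' \<subseteq> ?diff C C'"
          proof
            fix c assume c: "c \<in> ?diff C1 C'"
            then have "c \<noteq> j" "c \<noteq> k" using C1(5,6) jk(2,4) by auto
            then show "c \<in> ?diff C C'" using c C1(7) by simp
          qed
          have "j \<notin> ?diff C1 C'" "j \<in> ?diff C C'" using C1(6) jk(1,2) by simp_all
          then show "?diff C1 C' \<noteq> ?diff C C'" by metis
        qed
        then have "card (?diff C1 C') < card (?diff C C')" by (rule psubset_card_mono[OF fin_diff])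
        then have "equidistributed n D C1 C'"
          using less.hyps[OF _ C1(1) less.prems(2)] C1(3,4) less.prems(3,4) by simp
        then show ?thesis using C1(2) equidistributed_trans by blast
      qed
    qed
  qed
qed

section \<open>Row sizes read off the x-weight\<close>

lemma prod_single:
  "(\<Prod>x \<in> A. Poly_Mapping.single (f x) (1 :: int)) = Poly_Mapping.single (\<Sum>x \<in> A. f x) 1"
  for f :: "'a \<Rightarrow> 'b :: comm_monoid_add"
  by (induction A rule: infinite_finite_induct) (simp_all add: mult_single)

text \<open>The exponent of the indeterminate with index \<open>r\<close> counts the boxes in row
  \<open>r\<close>.\<close>

lemma card_row_eq_if_x_monomial_eq:
  assumes C: "diagram n C" "diagram n C'" and eq: "x_monomial n C = x_monomial n C'"
  shows "card {c. (r, c) \<in> C} = card {c. (r, c) \<in> C'}"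
proof -
  define e where "e E = (\<Sum>c \<in> {1..n}. \<Sum>i \<in> column E c. Poly_Mapping.single i (1 :: nat))" for E
  have mono: "x_monomial n E = Poly_Mapping.single (e E) 1" for E
    by (simp add: x_monomial_def indet_def prod_single e_def)
  have "e C = e C'"
    using eq unfolding mono by (metis lookup_single_eq lookup_single_not_eq zero_neq_one)
  moreover have "Poly_Mapping.lookup (e E) r = card {c. (r, c) \<in> E}" if "diagram n E" for E
  proof -
    have fin: "finite (column E c)" for c
      by (rule finite_subset[of _ "{1..n}"]) (use that in \<open>auto simp: diagram_def column_def\<close>)
    have "Poly_Mapping.lookup (e E) r = (\<Sum>c \<in> {1..n}. \<Sum>i \<in> column E c. if i = r then 1 :: nat else 0)"
      by (simp add: e_def lookup_sum lookup_single when_def del: One_nat_def)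
    also have "\<dots> = (\<Sum>c \<in> {1..n}. if (r, c) \<in> E then 1 :: nat else 0)"
      using fin by (simp add: column_def)
    also have "\<dots> = card ({1..n} \<inter> {c. (r, c) \<in> E})" by (simp add: sum.If_cases)
    also have "{1..n} \<inter> {c. (r, c) \<in> E} = {c. (r, c) \<in> E}" using that by (auto simp: diagram_def)
    finally show ?thesis .
  qed
  ultimately show ?thesis using C by metis
qed

theorem theorem4p1:
  fixes n :: nat and D C C' :: "(nat \<times> nat) set"
  assumes "diagram n D" and "normalized n D" and "multiplicity_free n D"
    and "diagram n C" and "diagram n C'" and "C \<noteq> C'"
    and "diagram_le n C D" and "diagram_le n C' D"
    and "x_monomial n C = x_monomial n C'"
  shows "\<exists>\<Omega>. bij_betw \<Omega> (flagged_fillings_content n D C) (flagged_fillings_content n D C') \<and>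
           (\<forall>F \<in> flagged_fillings_content n D C.
              filling_sgn n D (\<Omega> F) = filling_sgn n D F \<and>
              y_monomial D (\<Omega> F) = y_monomial D F)"
proof -
  have sub: "column E c \<subseteq> {1..n}" if "diagram n E" for E c
    using that by (auto simp: diagram_def column_def)
  have dom: "dominated_diagram n E D" if "diagram n E" "diagram_le n E D" for E
    using that dominated_if_subset_le[OF sub[OF that(1)] sub[OF assms(1)]]
    by (simp add: dominated_diagram_def diagram_le_def)
  have "(0, c) \<notin> E" if "diagram n E" for E c using that by (auto simp: diagram_def)
  \<comment> \<open>Starting at \<open>i = 0\<close> makes the agreement of the rows above
    \<open>i\<close> vacuous.\<close>
  then have "equidistributed n D C C'"
    using assms card_row_eq_if_x_monomial_eq[OF assms(4,5,9)]
    by (intro equidistributed_if_rows_agree[where i = 0] dom) auto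
  then show ?thesis unfolding equidistributed_def .
qed

end
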